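(* Let the closed-loop system and target covariances be as in the context. Suppose that the sequence of target covariances $(\Sigma_t)_{t\in[T]}$ satisfies the following: 1. $\Sigma_s$ is $\mathcal F_{t-\rho}$-measurable for all $s\in[t-\rho,t]$; 2. $\|\Sigma_{s+1}-\Sigma_s\|\le\bar\zeta$ for all $s\in[t-\rho,t]$; 3. $\Sigma_{s,xx}\succeq\Theta_\star\Sigma_s\Theta_\star^\top+W-\bar\eta_sI$ for all $s\in[t-\rho,t]$; 4. $0\preceq\Sigma_t\preceq\nu I$ for all $t$; 5. $\|x_{t-\rho}\|\le R_x$. Furthermore, if $\bar\zeta\le\frac{\bar\sigma^2}{2\nu}$, then it holds that $$\|m_{t|t-\rho}\|\le(1+\tilde\kappa)\tilde\kappa\exp(-\tilde\gamma\rho/2)R_x,$$ $$S_{t|t-\rho}-\Sigma_t\preceq(1+\tilde\kappa)^2\tilde\kappa^2\Big(\nu\exp(-\tilde\gamma\rho)+\rho\bar\zeta+\sum_{s=t-\rho}^{t}\bar\eta_s\Big)I ,$$ where $(\tilde\kappa,\tilde\gamma)=\big(\tfrac{\nu}{\bar\sigma},\tfrac{\bar\sigma}{2\nu}\big)$ and $\bar\sigma=\sigma-\max_{s\in[t-\rho,t]}\bar\eta_s$.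
   Context: System: $x_{s+1}=A_\star x_s+B_\star u_s+w_s$ with $x_s\in\mathbb R^n$, $u_s\in\mathbb R^m$, $w_s$ i.i.d. $\mathcal N(0,W)$, where $W\succeq\sigma I$ with $\sigma\in(0,1]$; $\Theta_\star=[A_\star\ B_\star]$; $z_s=(x_s^\top,u_s^\top)^\top$; $[T]=\{1,\dots,T\}$. $\|\cdot\|$ is the Euclidean/operator norm. $t$ is a time step and $\rho$ a delay (a number of time steps). Each target covariance $\Sigma_s$ is a (possibly random) symmetric $(n+m)\times(n+m)$ matrix with blocks $\Sigma_s=\begin{bmatrix}\Sigma_{s,xx}&\Sigma_{s,xu}\\ \Sigma_{s,ux}&\Sigma_{s,uu}\end{bmatrix}$, and determines the input by $K_s=\Sigma_{s,ux}\Sigma_{s,xx}^{-1}$, $U_s=\Sigma_{s,uu}-K_s\Sigma_{s,xx}K_s^\top$, $u_s=K_sx_s+v_s$, $v_s\sim\mathcal N(0,U_s)$. $\mathcal F_t$ is the $\sigma$-algebra induced by the randomness in the first $t$ time steps. $m_{t|t-\rho}=\mathbb E[z_t\mid\mathcal F_{t-\rho}]$ and $S_{t|t-\rho}=\mathrm{cov}(z_t\mid\mathcal F_{t-\rho})$ are the conditional mean and covariance.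
   Formalization: Two hypotheses are made explicit: $\bar\eta_s\ge 0$ for all $s\in[t-\rho,t]$ (for negative $\bar\eta_s$ the covariance bound can fail) and $\bar\sigma>0$ (otherwise $\tilde\kappa,\tilde\gamma$ are undefined or the bound on the mean can be negative). *)

theory Defs
  imports "HOL-Probability.Probability"
begin

definition psd :: "real ^ 'k ^ 'k \<Rightarrow> bool" where
  "psd P \<longleftrightarrow> transpose P = P \<and> (\<forall>\<xi>. 0 \<le> \<xi> \<bullet> (P *v \<xi>))"

definition loewner_le :: "real ^ 'k ^ 'k \<Rightarrow> real ^ 'k ^ 'k \<Rightarrow> bool" (infix "\<preceq>" 50) where
  "P \<preceq> Q \<longleftrightarrow> psd (Q - P)"

text \<open>The \<open>norm\<close> of the type of matrices is the Frobenius norm, hence the following.\<close>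

definition opnorm :: "real ^ 'k ^ 'l \<Rightarrow> real" where
  "opnorm P = onorm (\<lambda>\<xi>. P *v \<xi>)"


text \<open>Vectors and matrices over the index type \<open>'n + 'm\<close> are partitioned into a state part
  (\<open>Inl\<close>) and an input part (\<open>Inr\<close>).\<close>

definition stack :: "real ^ 'n \<Rightarrow> real ^ 'm \<Rightarrow> real ^ ('n::finite + 'm::finite)" where
  "stack x u = (\<chi> i. case i of Inl k \<Rightarrow> x $ k | Inr k \<Rightarrow> u $ k)"

definition hcat :: "real ^ 'n ^ 'l \<Rightarrow> real ^ 'm ^ 'l \<Rightarrow> real ^ ('n::finite + 'm::finite) ^ 'l" where
  "hcat A B = (\<chi> i j. case j of Inl k \<Rightarrow> A $ i $ k | Inr k \<Rightarrow> B $ i $ k)"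

definition block_xx :: "real ^ ('n::finite + 'm::finite) ^ ('n::finite + 'm::finite) \<Rightarrow> real ^ 'n ^ 'n" where
  "block_xx P = (\<chi> i j. P $ Inl i $ Inl j)"

definition block_ux :: "real ^ ('n::finite + 'm::finite) ^ ('n::finite + 'm::finite) \<Rightarrow> real ^ 'n ^ 'm" where
  "block_ux P = (\<chi> i j. P $ Inr i $ Inl j)"

definition block_uu :: "real ^ ('n::finite + 'm::finite) ^ ('n::finite + 'm::finite) \<Rightarrow> real ^ 'm ^ 'm" where
  "block_uu P = (\<chi> i j. P $ Inr i $ Inr j)"

definition gain :: "real ^ ('n::finite + 'm::finite) ^ ('n::finite + 'm::finite) \<Rightarrow> real ^ 'n ^ 'm" where
  "gain P = block_ux P ** matrix_inv (block_xx P)"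

definition input_cov :: "real ^ ('n::finite + 'm::finite) ^ ('n::finite + 'm::finite) \<Rightarrow> real ^ 'm ^ 'm" where
  "input_cov P = block_uu P - gain P ** block_xx P ** transpose (gain P)"


text \<open>The normal law with given mean and variance; variance \<open>0\<close> gives the point mass, which
  \<^const>\<open>normal_density\<close> does not cover. Input covariances may be singular, so a multivariate
  normal law is described by its one-dimensional projections and not by a density.\<close>

definition normal_law :: "real \<Rightarrow> real \<Rightarrow> real measure" where
  "normal_law a c =
    (if c = 0 then return borel a else density lborel (\<lambda>y. ennreal (normal_density a (sqrt c) y)))"

definition is_mvnormal :: "(real ^ 'k) measure \<Rightarrow> real ^ 'k \<Rightarrow> real ^ 'k ^ 'k \<Rightarrow> bool" where
  "is_mvnormal N \<mu> C \<longleftrightarrow> sets N = sets borel \<and> psd C \<and>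
    (\<forall>\<xi>. distr N borel (\<lambda>y. \<xi> \<bullet> y) = normal_law (\<xi> \<bullet> \<mu>) (\<xi> \<bullet> (C *v \<xi>)))"

text \<open>The kernel \<open>\<kappa>\<close> is a regular conditional distribution of \<open>X\<close> given \<open>G\<close>.\<close>

definition cond_law ::
  "'a measure \<Rightarrow> 'a measure \<Rightarrow> ('a \<Rightarrow> 'b::topological_space) \<Rightarrow> ('a \<Rightarrow> 'b measure) \<Rightarrow> bool" where
  "cond_law M G X \<kappa> \<longleftrightarrow> \<kappa> \<in> measurable G (prob_algebra borel) \<and>
    (\<forall>E\<in>sets borel. AE \<omega> in M.
       real_cond_exp M G (indicator (X -` E \<inter> space M)) \<omega> = measure (\<kappa> \<omega>) E)"

definition cond_mean :: "'a measure \<Rightarrow> 'a measure \<Rightarrow> ('a \<Rightarrow> real ^ 'k) \<Rightarrow> 'a \<Rightarrow> real ^ 'k" where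
  "cond_mean M G Z \<omega> = (\<chi> i. real_cond_exp M G (\<lambda>\<omega>'. Z \<omega>' $ i) \<omega>)"

definition cond_cov :: "'a measure \<Rightarrow> 'a measure \<Rightarrow> ('a \<Rightarrow> real ^ 'k) \<Rightarrow> 'a \<Rightarrow> real ^ 'k ^ 'k" where
  "cond_cov M G Z \<omega> = (\<chi> i j. real_cond_exp M G
     (\<lambda>\<omega>'. (Z \<omega>' $ i - cond_mean M G Z \<omega>' $ i) * (Z \<omega>' $ j - cond_mean M G Z \<omega>' $ j)) \<omega>)"


abbreviation generated_sets :: "'a measure \<Rightarrow> ('a \<Rightarrow> 'b::topological_space) \<Rightarrow> 'a set set" where
  "generated_sets M X \<equiv> sets (vimage_algebra (space M) X borel)"

text \<open>The \<open>\<sigma>\<close>-algebra of the randomness that determines the state \<open>x\<^sub>t\<close> and the target covariance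
  in force at time \<open>t\<close>. The noises \<open>v\<^sub>t\<close> and \<open>w\<^sub>t\<close>, which are drawn after \<open>x\<^sub>t\<close> is known, are not
  included; they first act on \<open>u\<^sub>t\<close> and \<open>x\<^sub>t\<^sub>+\<^sub>1\<close>.\<close>

definition history ::
  "'a measure \<Rightarrow> ('a \<Rightarrow> real ^ 'n) \<Rightarrow> (nat \<Rightarrow> 'a \<Rightarrow> real ^ 'm) \<Rightarrow> (nat \<Rightarrow> 'a \<Rightarrow> real ^ 'n)
    \<Rightarrow> (nat \<Rightarrow> 'a \<Rightarrow> real ^ ('n::finite + 'm::finite) ^ ('n::finite + 'm::finite)) \<Rightarrow> nat \<Rightarrow> 'a measure" where
  "history M x1 v w \<Sigma> t = sigma (space M)
     (generated_sets M x1 \<union> (\<Union>s\<in>{1..t}. generated_sets M (\<Sigma> s)) \<union>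
      (\<Union>s\<in>{1..<t}. generated_sets M (v s) \<union> generated_sets M (w s)))"

text \<open>The closed loop over the time steps \<open>1, \<dots>, T\<close>. As \<open>\<Sigma>\<^sub>s\<close> is random and part of
  the history, \<open>v\<^sub>s \<sim> N(0, U\<^sub>s)\<close> is a statement about the conditional law given the history; the
  process noise \<open>w\<^sub>s\<close> is independent of the history and of \<open>v\<^sub>s\<close>.\<close>

locale closed_loop = prob_space M
  for M :: "'a measure"
    and A :: "real ^ 'n ^ 'n" and B :: "real ^ 'm ^ 'n" and W :: "real ^ 'n ^ 'n"
    and \<sigma> :: real and T :: nat
    and x :: "nat \<Rightarrow> 'a \<Rightarrow> real ^ 'n" and u :: "nat \<Rightarrow> 'a \<Rightarrow> real ^ 'm"
    and v :: "nat \<Rightarrow> 'a \<Rightarrow> real ^ 'm" and w :: "nat \<Rightarrow> 'a \<Rightarrow> real ^ 'n"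
    and \<Sigma> :: "nat \<Rightarrow> 'a \<Rightarrow> real ^ ('n::finite + 'm::finite) ^ ('n::finite + 'm::finite)" +
  assumes sigma_pos: "0 < \<sigma>" and sigma_le_1: "\<sigma> \<le> 1"
    and noise_cov: "mat \<sigma> \<preceq> W"
    and x1_measurable: "x 1 \<in> borel_measurable M"
    and target_measurable: "s \<in> {1..T} \<Longrightarrow> \<Sigma> s \<in> borel_measurable M"
    and v_measurable: "s \<in> {1..T} \<Longrightarrow> v s \<in> borel_measurable M"
    and target_symmetric: "s \<in> {1..T} \<Longrightarrow> \<omega> \<in> space M \<Longrightarrow> transpose (\<Sigma> s \<omega>) = \<Sigma> s \<omega>"
    and state_eq: "s \<in> {1..T} \<Longrightarrow> \<omega> \<in> space M \<Longrightarrow> x (Suc s) \<omega> = A *v x s \<omega> + B *v u s \<omega> + w s \<omega>"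
    and input_eq: "s \<in> {1..T} \<Longrightarrow> \<omega> \<in> space M \<Longrightarrow> u s \<omega> = gain (\<Sigma> s \<omega>) *v x s \<omega> + v s \<omega>"
    and w_indep: "indep_vars (\<lambda>_. borel) w {1..T}"
    and w_normal: "s \<in> {1..T} \<Longrightarrow> is_mvnormal (distr M borel (w s)) 0 W"
    and w_fresh: "s \<in> {1..T} \<Longrightarrow> indep_set
        (sigma_sets (space M) (sets (history M (x 1) v w \<Sigma> s) \<union> generated_sets M (v s)))
        (generated_sets M (w s))"
    and v_normal: "s \<in> {1..T} \<Longrightarrow> \<exists>\<kappa>. cond_law M (history M (x 1) v w \<Sigma> s) (v s) \<kappa> \<and>
        (AE \<omega> in M. is_mvnormal (\<kappa> \<omega>) 0 (input_cov (\<Sigma> s \<omega>)))"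

end

theory Submission
  imports Defs
begin

text \<open>Conditionally on \<open>F\<^sub>r\<close>, \<open>r = t - \<rho>\<close>, the targets \<open>\<Sigma>\<^sub>r, \<dots>, \<Sigma>\<^sub>t\<close> are constants and the closed loop is a
  linear system \<open>x\<^sub>s\<^sub>+\<^sub>1 = L\<^sub>s x\<^sub>s + B v\<^sub>s + w\<^sub>s\<close> with \<open>L\<^sub>s = A + B K\<^sub>s\<close>. Hence the conditional mean of the state is a
  product of the \<open>L\<^sub>s\<close> applied to \<open>x\<^sub>r\<close>, and its conditional covariance obeys
  \<open>S\<^sub>s\<^sub>+\<^sub>1 = L\<^sub>s S\<^sub>s L\<^sub>s\<^sup>T + B U\<^sub>s B\<^sup>T + W\<close> with \<open>S\<^sub>r = 0\<close>.

  With \<open>P\<^sub>s = \<Sigma>\<^sub>s\<^sub>,\<^sub>x\<^sub>x\<close>, completing the square in \<open>\<Sigma>\<^sub>s\<close> turns the stationarity hypothesis into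
  \<open>L\<^sub>s P\<^sub>s L\<^sub>s\<^sup>T + B U\<^sub>s B\<^sup>T + W \<preceq> P\<^sub>s + \<eta>\<^sub>s I\<close>; as \<open>\<sigma>' I \<preceq> P\<^sub>s \<preceq> \<nu> I\<close> and the drift is slow, this gives
  \<open>L\<^sub>s P\<^sub>s L\<^sub>s\<^sup>T \<preceq> (1 - \<gamma>) P\<^sub>s\<^sub>+\<^sub>1\<close>. So the squared transition matrix is dominated by \<open>(1 - \<gamma>)\<^sup>\<rho> P\<^sub>t / \<sigma>'\<close>, and
  by induction \<open>S\<^sub>s \<preceq> (1 + \<Sum>\<^sub>i (\<eta>\<^sub>i + \<zeta>) / \<sigma>') P\<^sub>s\<close>, which are the two bounds up to the factor for
  passing from \<open>x\<^sub>t\<close> to \<open>z\<^sub>t\<close>.\<close>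

section \<open>Covariance matrices partitioned into state and input\<close>

lemma inner_stack: "stack a b \<bullet> stack c d = a \<bullet> c + b \<bullet> d"
proof -
  have "stack a b \<bullet> stack c d = (\<Sum>i\<in>UNIV <+> UNIV. stack a b $ i \<bullet> stack c d $ i)"
    by (simp add: inner_vec_def)
  also have "\<dots> = a \<bullet> c + b \<bullet> d"
    by (subst sum.Plus) (simp_all add: inner_vec_def stack_def)
  finally show ?thesis .
qed

lemma stack_exists: obtains a b where "\<xi> = stack a b"
proof
  show "\<xi> = stack (\<chi> i. \<xi> $ Inl i) (\<chi> i. \<xi> $ Inr i)"
    by (auto simp: stack_def vec_eq_iff split: sum.split)
qed

lemma norm_stack_ge: "norm a \<le> norm (stack a b)" "norm b \<le> norm (stack a b)"
  unfolding norm_eq_sqrt_inner inner_stack by simp_all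

lemma vector_hcat_mult: "\<xi> v* hcat P Q = stack (\<xi> v* P) (\<xi> v* Q)"
  by (auto simp: vec_eq_iff stack_def hcat_def vector_matrix_mult_def split: sum.split)

lemma transpose_nth_sym:
  assumes "transpose S = S"
  shows "S $ i $ j = S $ j $ i"
proof -
  have "transpose S $ i $ j = S $ j $ i"
    by (simp add: transpose_def)
  then show ?thesis
    using assms by simp
qed

lemma inner_block_mult:
  assumes "transpose S = S"
  shows "stack a b \<bullet> (S *v stack a b) =
    a \<bullet> (block_xx S *v a) + 2 * (b \<bullet> (block_ux S *v a)) + b \<bullet> (block_uu S *v b)"
proof -
  note sym = transpose_nth_sym[OF assms]
  \<comment> \<open>By symmetry the two cross terms coincide, which yields the factor 2.\<close>
  have xu: "(\<Sum>i\<in>UNIV. \<Sum>j\<in>UNIV. a $ i * (S $ Inl i $ Inr j * b $ j)) =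
      (\<Sum>j\<in>UNIV. \<Sum>i\<in>UNIV. b $ j * (S $ Inr j $ Inl i * a $ i))"
    by (subst sum.swap) (intro sum.cong refl, simp add: sym[of "Inl _"] mult_ac)
  have "stack a b \<bullet> (S *v stack a b) = (\<Sum>i\<in>UNIV <+> UNIV. \<Sum>j\<in>UNIV <+> UNIV.
      stack a b $ i * (S $ i $ j * stack a b $ j))"
    by (simp add: inner_vec_def matrix_vector_mult_def sum_distrib_left)
  also have "\<dots> = a \<bullet> (block_xx S *v a) + 2 * (b \<bullet> (block_ux S *v a)) + b \<bullet> (block_uu S *v b)"
    by (simp only: sum.Plus[OF finite finite] sum.distrib)
      (simp add: stack_def block_xx_def block_ux_def block_uu_def inner_vec_def
        matrix_vector_mult_def sum_distrib_left sum.distrib xu)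
  finally show ?thesis .
qed

lemma transpose_block_xx:
  assumes "transpose S = S"
  shows "transpose (block_xx S) = block_xx S"
  by (simp add: transpose_def block_xx_def vec_eq_iff) (intro allI transpose_nth_sym[OF assms])

lemma transpose_diff:
  fixes P Q :: "real^'n^'m"
  shows "transpose (P - Q) = transpose P - transpose Q"
  by (simp add: transpose_def vec_eq_iff)

lemma matrix_inv_left:
  fixes P :: "real^'n^'n"
  assumes "invertible P"
  shows "matrix_inv P ** P = mat 1"
  using someI_ex[OF assms[unfolded invertible_def]] by (simp add: matrix_inv_def)

lemma gain_block_xx:
  assumes "invertible (block_xx S)"
  shows "gain S ** block_xx S = block_ux S"
  by (simp add: gain_def matrix_mul_assoc[symmetric] matrix_inv_left[OF assms])

text \<open>Since \<open>gain S ** block_xx S = block_ux S\<close>, shifting \<open>a\<close> by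
  \<open>b v* gain S\<close> absorbs the cross terms. What is left in \<open>b\<close> alone is the
  Schur complement of the state block, which is \<open>input_cov S\<close>.\<close>

lemma inner_complete_square:
  assumes S: "transpose S = S" and inv: "invertible (block_xx S)"
  shows "stack a b \<bullet> (S *v stack a b) =
    (a + b v* gain S) \<bullet> (block_xx S *v (a + b v* gain S)) + b \<bullet> (input_cov S *v b)"
proof -
  let ?P = "block_xx S" and ?K = "gain S"
  have 1: "b \<bullet> (block_ux S *v a) = (b v* ?K) \<bullet> (?P *v a)"
    by (simp add: gain_block_xx[OF inv, symmetric] dot_lmul_matrix matrix_vector_mul_assoc)
  have 2: "a \<bullet> (?P *v (b v* ?K)) = (b v* ?K) \<bullet> (?P *v a)"
    by (metis dot_lmul_matrix inner_commute transpose_block_xx[OF S] transpose_matrix_vector)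
  have 3: "b \<bullet> (input_cov S *v b) = b \<bullet> (block_uu S *v b) - (b v* ?K) \<bullet> (?P *v (b v* ?K))"
    by (simp add: input_cov_def dot_lmul_matrix matrix_vector_mult_diff_rdistrib inner_diff_right
        flip: matrix_vector_mul_assoc)
  show ?thesis
    unfolding inner_block_mult[OF S] 1 3
    by (simp add: inner_add_left inner_add_right matrix_vector_right_distrib 2)
qed

lemma inner_congruence:
  fixes P :: "real^'n^'m" and S :: "real^'n^'n"
  shows "\<xi> \<bullet> ((P ** S ** transpose P) *v \<xi>) = (\<xi> v* P) \<bullet> (S *v (\<xi> v* P))"
  by (simp add: dot_lmul_matrix flip: matrix_vector_mul_assoc)

section \<open>The Loewner order through quadratic forms\<close>

lemma matrix_vector_mult_mat: "mat c *v \<xi> = c *\<^sub>R (\<xi> :: real^'n)"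
proof -
  have "(\<Sum>j\<in>UNIV. (if i = j then c else 0) * \<xi> $ j) = c * \<xi> $ i" for i
    by (subst sum.remove[of _ i]) auto
  then show ?thesis
    by (simp add: vec_eq_iff matrix_vector_mult_def mat_def)
qed

lemma loewner_leD:
  assumes "P \<preceq> Q"
  shows "\<xi> \<bullet> (P *v \<xi>) \<le> \<xi> \<bullet> (Q *v \<xi>)"
  using assms by (simp add: loewner_le_def psd_def matrix_vector_mult_diff_rdistrib inner_diff_right)

lemma loewner_leI:
  assumes "transpose P = P" "transpose Q = Q" "\<And>\<xi>. \<xi> \<bullet> (P *v \<xi>) \<le> \<xi> \<bullet> (Q *v \<xi>)"
  shows "P \<preceq> Q"
  using assms
  by (simp add: loewner_le_def psd_def matrix_vector_mult_diff_rdistrib inner_diff_right transpose_diff)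

text \<open>A single target with its slack, free of probability. The noise is at least
  \<open>\<sigma>' + \<eta>\<close>, so after the slack \<eta> of the stationarity inequality is
  paid, the margin \<sigma>' remains.\<close>

locale contractive_target =
  fixes A :: "real ^ 'n ^ 'n" and B :: "real ^ 'm ^ 'n" and W :: "real ^ 'n ^ 'n"
    and S :: "real ^ ('n::finite + 'm::finite) ^ ('n::finite + 'm::finite)" and \<sigma>' \<eta> \<nu> :: real
  assumes bounds: "0 \<preceq> S" "S \<preceq> mat \<nu>"
    and noise: "mat (\<sigma>' + \<eta>) \<preceq> W" and margin: "0 < \<sigma>'"
    and stationary: "hcat A B ** S ** transpose (hcat A B) + W - mat \<eta> \<preceq> block_xx S"
begin

lemma symmetric: "transpose S = S"
  using bounds(1) by (simp add: loewner_le_def psd_def)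

lemma quadratic_bounds: "0 \<le> \<xi> \<bullet> (S *v \<xi>)" "\<xi> \<bullet> (S *v \<xi>) \<le> \<nu> * (norm \<xi>)\<^sup>2"
  using loewner_leD[OF bounds(1), of \<xi>] loewner_leD[OF bounds(2), of \<xi>]
  by (simp_all add: matrix_vector_mult_mat power2_norm_eq_inner)

lemma stationary_quadratic:
  "stack (\<xi> v* A) (\<xi> v* B) \<bullet> (S *v stack (\<xi> v* A) (\<xi> v* B)) + \<xi> \<bullet> (W *v \<xi>) - \<eta> * (norm \<xi>)\<^sup>2
    \<le> \<xi> \<bullet> (block_xx S *v \<xi>)"
  using loewner_leD[OF stationary, of \<xi>]
  by (simp add: matrix_vector_mult_diff_rdistrib matrix_vector_mult_add_rdistrib inner_diff_right
      inner_add_right inner_congruence[unfolded transpose_matrix_vector] vector_hcat_mult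
      matrix_vector_mult_mat power2_norm_eq_inner)

lemma noise_quadratic: "(\<sigma>' + \<eta>) * (norm \<xi>)\<^sup>2 \<le> \<xi> \<bullet> (W *v \<xi>)"
  using loewner_leD[OF noise, of \<xi>] by (simp add: matrix_vector_mult_mat power2_norm_eq_inner)

text \<open>Dropping the positive semidefinite term through \<open>hcat A B\<close> from
  stationarity leaves \<open>W - mat \<eta>\<close>, whose form is at least \<sigma>' times the
  squared norm.\<close>

lemma state_lower: "\<sigma>' * (norm \<xi>)\<^sup>2 \<le> \<xi> \<bullet> (block_xx S *v \<xi>)"
  using stationary_quadratic[of \<xi>] noise_quadratic[of \<xi>]
    quadratic_bounds(1)[of "stack (\<xi> v* A) (\<xi> v* B)"] by (simp add: algebra_simps)

lemma state_upper: "\<xi> \<bullet> (block_xx S *v \<xi>) \<le> \<nu> * (norm \<xi>)\<^sup>2"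
proof -
  have "norm (stack \<xi> (0 :: real^'m)) = norm \<xi>"
    by (simp add: norm_eq_sqrt_inner inner_stack)
  then show ?thesis
    using quadratic_bounds(2)[of "stack \<xi> 0"] by (simp add: inner_block_mult[OF symmetric])
qed

lemma margin_le: "\<sigma>' \<le> \<nu>"
proof -
  \<comment> \<open>Any unit vector serves to compare the two bounds; one exists because index types
    are nonempty.\<close>
  have "\<sigma>' * (norm (axis undefined 1 :: real^'n))\<^sup>2 \<le> \<nu> * (norm (axis undefined 1 :: real^'n))\<^sup>2"
    using state_lower state_upper by (rule order_trans)
  then show ?thesis by simp
qed

lemma state_invertible: "invertible (block_xx S)"
proof -
  have "\<xi> = 0" if "block_xx S *v \<xi> = 0" for \<xi>
    using state_lower[of \<xi>] margin that by (simp add: mult_le_0_iff)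
  then show ?thesis
    by (metis invertible_left_inverse matrix_left_invertible_ker)
qed

lemmas complete_square = inner_complete_square[OF symmetric state_invertible]

text \<open>The state part \<open>- (b v* gain S)\<close> makes the square vanish and leaves only
  the Schur complement.\<close>

lemma input_cov_nonneg: "0 \<le> b \<bullet> (input_cov S *v b)"
  using quadratic_bounds(1)[of "stack (- (b v* gain S)) b"] by (simp add: complete_square)

text \<open>\<open>S\<close> is tested with zero state part. As the Schur complement is nonnegative,
  the form of the state block at \<open>b v* gain S\<close> is at most that of \<open>S\<close>, and
  \<open>state_lower\<close> turns this into a bound on the vector.\<close>

lemma gain_bound: "(norm (b v* gain S))\<^sup>2 \<le> \<nu> / \<sigma>' * (norm b)\<^sup>2"
proof -
  have "\<sigma>' * (norm (b v* gain S))\<^sup>2 \<le> (b v* gain S) \<bullet> (block_xx S *v (b v* gain S))"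
    by (rule state_lower)
  also have "\<dots> \<le> stack 0 b \<bullet> (S *v stack 0 b)"
    using input_cov_nonneg[of b] by (simp add: complete_square)
  also have "\<dots> \<le> \<nu> * (norm b)\<^sup>2"
    using quadratic_bounds(2)[of "stack 0 b"] by (simp add: power2_norm_eq_inner inner_stack)
  finally show ?thesis
    using margin by (simp add: field_simps)
qed

text \<open>This bounds the transpose of the identity stacked over the gain. It is the source of the
  factor \<open>1 + \<kappa>\<close> for passing from the state to the state-input vector.\<close>

lemma norm_lift_le: "norm (a + b v* gain S) \<le> (1 + \<nu> / \<sigma>') * norm (stack a b)"
proof -
  have 1: "1 \<le> \<nu> / \<sigma>'"
    using margin_le margin by simp
  \<comment> \<open>The square root of \<open>\<nu> / \<sigma>'\<close> bounds the gain; the ratio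
    is at least 1, so it is a bound as well.\<close>
  have "(norm (b v* gain S))\<^sup>2 \<le> (\<nu> / \<sigma>' * norm b)\<^sup>2"
  proof -
    have "\<nu> / \<sigma>' * (norm b)\<^sup>2 \<le> (\<nu> / \<sigma>')\<^sup>2 * (norm b)\<^sup>2"
      using 1 by (intro mult_right_mono) (simp_all add: self_le_power)
    then show ?thesis
      using gain_bound[of b] unfolding power_mult_distrib by linarith
  qed
  then have "norm (b v* gain S) \<le> \<nu> / \<sigma>' * norm b"
    by (rule power2_le_imp_le) (use margin margin_le in simp)
  also have "\<dots> \<le> \<nu> / \<sigma>' * norm (stack a b)"
    by (intro mult_left_mono norm_stack_ge) (use margin margin_le in simp)
  finally show ?thesis
    using norm_triangle_ineq[of a "b v* gain S"] norm_stack_ge(1)[of a b] by (simp add: distrib_right)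
qed

text \<open>The vector \<open>stack (\<xi> v* A) (\<xi> v* B)\<close> in the stationarity inequality
  has \<open>\<xi> v* (A + B ** gain S)\<close> as its completed state part, so completing the
  square separates feedback from input noise.\<close>

lemma closed_loop_quadratic:
  "(\<xi> v* (A + B ** gain S)) \<bullet> (block_xx S *v (\<xi> v* (A + B ** gain S)))
    + (\<xi> v* B) \<bullet> (input_cov S *v (\<xi> v* B)) + \<xi> \<bullet> (W *v \<xi>)
    \<le> \<xi> \<bullet> (block_xx S *v \<xi>) + \<eta> * (norm \<xi>)\<^sup>2"
proof -
  have "\<xi> v* (A + B ** gain S) = \<xi> v* A + (\<xi> v* B) v* gain S"
    by (simp add: vector_matrix_mul_assoc vector_matrix_mult_add_rdistrib)
  then show ?thesis
    using stationary_quadratic[of \<xi>] by (simp add: complete_square)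
qed

text \<open>The noise left after the slack is at least \<sigma>' times the squared norm, hence at
  least the fraction \<open>\<sigma>' / \<nu>\<close> of the form, since \<nu> bounds the state
  block. The nonnegative input noise is dropped.\<close>

lemma closed_loop_contraction:
  "(\<xi> v* (A + B ** gain S)) \<bullet> (block_xx S *v (\<xi> v* (A + B ** gain S)))
    \<le> (1 - \<sigma>' / \<nu>) * (\<xi> \<bullet> (block_xx S *v \<xi>))"
proof -
  have "\<sigma>' / \<nu> * (\<xi> \<bullet> (block_xx S *v \<xi>)) \<le> \<sigma>' / \<nu> * (\<nu> * (norm \<xi>)\<^sup>2)"
    by (intro mult_left_mono state_upper) (use margin margin_le in simp)
  also have "\<dots> = \<sigma>' * (norm \<xi>)\<^sup>2"
    using margin margin_le by simp
  finally show ?thesis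
    using closed_loop_quadratic[of \<xi>] noise_quadratic[of \<xi>] input_cov_nonneg[of "\<xi> v* B"]
    by (simp add: algebra_simps)
qed

end

section \<open>Time-varying contraction\<close>

primrec transition :: "(nat \<Rightarrow> real ^ 'n ^ 'n) \<Rightarrow> nat \<Rightarrow> real ^ 'n ^ 'n" where
  "transition L 0 = mat 1"
| "transition L (Suc j) = L j ** transition L j"

text \<open>The Lyapunov recursion, started at 0 because the state at the start of the window is
  known.\<close>

primrec state_cov :: "(nat \<Rightarrow> real ^ 'n ^ 'n) \<Rightarrow> (nat \<Rightarrow> real ^ 'n ^ 'n) \<Rightarrow> nat \<Rightarrow> real ^ 'n ^ 'n" where
  "state_cov L N 0 = 0"
| "state_cov L N (Suc j) = L j ** state_cov L N j ** transpose (L j) + N j"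

text \<open>The identity stacked over \<open>K\<close>. With \<open>input_inclusion\<close>, zero
  stacked over the identity, the state-input vector is
  \<open>feedback K *v x + input_inclusion *v v\<close>.\<close>

definition feedback :: "real ^ 'n ^ 'm \<Rightarrow> real ^ 'n ^ ('n::finite + 'm::finite)" where
  "feedback K = transpose (hcat (mat 1) (transpose K))"

definition input_inclusion :: "real ^ 'm ^ ('n::finite + 'm::finite)" where
  "input_inclusion = transpose (hcat 0 (mat 1))"

lemma hcat_mult_stack: "hcat P Q *v stack a b = P *v a + Q *v b"
proof -
  have "(hcat P Q *v stack a b) $ i = (P *v a + Q *v b) $ i" for i
  proof -
    have "(hcat P Q *v stack a b) $ i = (\<Sum>j\<in>UNIV <+> UNIV. hcat P Q $ i $ j * stack a b $ j)"
      by (simp add: matrix_vector_mult_def)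
    also have "\<dots> = (P *v a + Q *v b) $ i"
      by (subst sum.Plus) (simp_all add: matrix_vector_mult_def hcat_def stack_def)
    finally show ?thesis .
  qed
  then show ?thesis by (simp add: vec_eq_iff)
qed

lemma feedback_mult [simp]:
  "feedback K *v y = stack y (K *v y)" "stack a b v* feedback K = a + b v* K"
  unfolding feedback_def by (simp_all add: vector_hcat_mult hcat_mult_stack)

lemma input_inclusion_mult [simp]:
  "input_inclusion *v y = stack 0 y" "stack a b v* input_inclusion = b"
  unfolding input_inclusion_def by (simp_all add: vector_hcat_mult hcat_mult_stack)

lemma abs_inner_matrix_le_opnorm:
  fixes P :: "real ^ 'n ^ 'n"
  shows "\<bar>\<xi> \<bullet> (P *v \<xi>)\<bar> \<le> opnorm P * (norm \<xi>)\<^sup>2"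
proof -
  have "\<bar>\<xi> \<bullet> (P *v \<xi>)\<bar> \<le> norm \<xi> * norm (P *v \<xi>)"
    by (rule Cauchy_Schwarz_ineq2)
  also have "\<dots> \<le> norm \<xi> * (opnorm P * norm \<xi>)"
    unfolding opnorm_def by (intro mult_left_mono onorm) simp_all
  finally show ?thesis
    by (simp add: power2_eq_square mult_ac)
qed

lemma opnorm_nonneg: "0 \<le> opnorm P"
  unfolding opnorm_def by (rule onorm_pos_le) simp

text \<open>The whole window along one outcome, with \<open>j\<close> counting steps from its start.
  Drift compares consecutive targets inside the window, hence \<open>j < \<rho>\<close>
  there.\<close>

locale drifting_targets =
  fixes A :: "real ^ 'n ^ 'n" and B :: "real ^ 'm ^ 'n" and W :: "real ^ 'n ^ 'n"
    and S :: "nat \<Rightarrow> real ^ ('n::finite + 'm::finite) ^ ('n::finite + 'm::finite)"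
    and \<sigma>' \<nu> \<zeta> :: real and \<eta> :: "nat \<Rightarrow> real" and \<rho> :: nat
  assumes targets: "j \<le> \<rho> \<Longrightarrow> contractive_target A B W (S j) \<sigma>' (\<eta> j) \<nu>"
    and eta: "j \<le> \<rho> \<Longrightarrow> 0 \<le> \<eta> j"
    and drift: "j < \<rho> \<Longrightarrow> opnorm (S (Suc j) - S j) \<le> \<zeta>"
    and slow: "\<zeta> \<le> \<sigma>'\<^sup>2 / (2 * \<nu>)"
begin

abbreviation "L j \<equiv> A + B ** gain (S j)"
abbreviation "N j \<equiv> B ** input_cov (S j) ** transpose B + W"
text \<open>The quadratic form serving as time-varying Lyapunov function.\<close>

abbreviation "q j \<xi> \<equiv> \<xi> \<bullet> (block_xx (S j) *v \<xi>)"
text \<open>Half of the one-step rate \<open>\<sigma>' / \<nu>\<close>; the other half pays for the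
  drift of the targets.\<close>

abbreviation "\<gamma> \<equiv> \<sigma>' / (2 * \<nu>)"
abbreviation "\<kappa> \<equiv> \<nu> / \<sigma>'"

lemma margin: "0 < \<sigma>'" "\<sigma>' \<le> \<nu>" "0 < \<nu>"
  using contractive_target.margin[OF targets[of 0]] contractive_target.margin_le[OF targets[of 0]]
  by auto

lemma rate: "0 < \<gamma>" "2 * \<gamma> \<le> 1" "1 \<le> \<kappa>"
  using margin by (simp_all add: field_simps)

text \<open>Padding \<xi> with a zero input part keeps its norm and turns the difference of state
  blocks into a restriction of the difference of targets.\<close>

lemma quadratic_drift:
  assumes "j < \<rho>"
  shows "q j \<xi> \<le> q (Suc j) \<xi> + \<zeta> * (norm \<xi>)\<^sup>2"
proof -
  interpret s: contractive_target A B W "S j" \<sigma>' "\<eta> j" \<nu> using assms by (intro targets) simp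
  interpret s': contractive_target A B W "S (Suc j)" \<sigma>' "\<eta> (Suc j)" \<nu> using assms by (intro targets) simp
  let ?\<xi> = "stack \<xi> (0 :: real ^ 'm)"
  have "?\<xi> \<bullet> ((S (Suc j) - S j) *v ?\<xi>) = q (Suc j) \<xi> - q j \<xi>"
    by (simp add: matrix_vector_mult_diff_rdistrib inner_diff_right inner_block_mult s.symmetric s'.symmetric)
  moreover have "norm ?\<xi> = norm \<xi>"
    by (simp add: norm_eq_sqrt_inner inner_stack)
  ultimately have "\<bar>q (Suc j) \<xi> - q j \<xi>\<bar> \<le> opnorm (S (Suc j) - S j) * (norm \<xi>)\<^sup>2"
    using abs_inner_matrix_le_opnorm[of ?\<xi> "S (Suc j) - S j"] by simp
  also have "\<dots> \<le> \<zeta> * (norm \<xi>)\<^sup>2"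
    using drift[OF assms] by (rule mult_right_mono) simp
  finally show ?thesis by simp
qed

lemma norm_le_quadratic: "j \<le> \<rho> \<Longrightarrow> (norm \<xi>)\<^sup>2 \<le> q j \<xi> / \<sigma>'"
  using contractive_target.state_lower[OF targets[of j], of \<xi>] margin by (simp add: field_simps)

lemma quadratic_nonneg: "j \<le> \<rho> \<Longrightarrow> 0 \<le> q j \<xi>"
  using contractive_target.state_lower[OF targets[of j], of \<xi>] margin
  by (metis linorder_not_less mult_nonneg_nonneg order.strict_implies_order order_trans zero_le_power2)

text \<open>The one-step factor \<open>1 - 2 * \<gamma>\<close> is relative to the target at
  \<open>j\<close>. Passing to the next target costs a factor \<open>1 + \<gamma>\<close>, and the
  product of the two is at most \<open>1 - \<gamma>\<close>.\<close>

lemma quadratic_contraction: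
  assumes "j < \<rho>"
  shows "q j (\<xi> v* L j) \<le> (1 - \<gamma>) * q (Suc j) \<xi>"
proof -
  \<comment> \<open>The bound on \<zeta> equals \<open>\<gamma> * \<sigma>'\<close>, so the additive
    drift becomes the multiple \<gamma> of the next form.\<close>
  have "\<zeta> * (norm \<xi>)\<^sup>2 \<le> \<sigma>'\<^sup>2 / (2 * \<nu>) * (norm \<xi>)\<^sup>2"
    using slow by (rule mult_right_mono) simp
  also have "\<dots> \<le> \<sigma>'\<^sup>2 / (2 * \<nu>) * (q (Suc j) \<xi> / \<sigma>')"
    using assms margin by (intro mult_left_mono norm_le_quadratic) simp_all
  also have "\<dots> = \<gamma> * q (Suc j) \<xi>"
    using margin by (simp add: power2_eq_square)
  finally have 1: "q j \<xi> \<le> (1 + \<gamma>) * q (Suc j) \<xi>"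
    using quadratic_drift[OF assms, of \<xi>] by (simp add: distrib_right)
  have "q j (\<xi> v* L j) \<le> (1 - \<sigma>' / \<nu>) * q j \<xi>"
    using assms by (intro contractive_target.closed_loop_contraction[OF targets]) simp
  also have "\<sigma>' / \<nu> = 2 * \<gamma>" by simp
  also have "(1 - 2 * \<gamma>) * q j \<xi> \<le> (1 - 2 * \<gamma>) * ((1 + \<gamma>) * q (Suc j) \<xi>)"
    using 1 rate by (intro mult_left_mono) simp_all
  also have "\<dots> = ((1 - 2 * \<gamma>) * (1 + \<gamma>)) * q (Suc j) \<xi>" by (simp only: mult.assoc)
  also have "\<dots> \<le> (1 - \<gamma>) * q (Suc j) \<xi>"
  proof (rule mult_right_mono)
    have "(1 - 2 * \<gamma>) * (1 + \<gamma>) = 1 - \<gamma> - 2 * (\<gamma> * \<gamma>)" by (simp only: algebra_simps)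
    then show "(1 - 2 * \<gamma>) * (1 + \<gamma>) \<le> 1 - \<gamma>" by simp
  qed (use assms in \<open>simp add: quadratic_nonneg\<close>)
  finally show ?thesis .
qed

text \<open>Decay in dual form: the rank-one matrix of the image of \<open>y\<close> is dominated by
  a multiple of the current state block. The induction moves \<xi> backwards through
  \<open>L j\<close>, where contraction applies, so \<xi> must be arbitrary.\<close>

lemma transition_quadratic:
  "j \<le> \<rho> \<Longrightarrow> (\<xi> \<bullet> (transition L j *v y))\<^sup>2 \<le> (1 - \<gamma>) ^ j * (norm y)\<^sup>2 / \<sigma>' * q j \<xi>"
proof (induction j arbitrary: \<xi>)
  case 0
  have "(\<xi> \<bullet> y)\<^sup>2 \<le> (norm \<xi>)\<^sup>2 * (norm y)\<^sup>2"
    using Cauchy_Schwarz_ineq[of \<xi> y] by (simp add: power2_norm_eq_inner)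
  also have "\<dots> \<le> q 0 \<xi> / \<sigma>' * (norm y)\<^sup>2"
    by (intro mult_right_mono norm_le_quadratic) simp_all
  finally show ?case by (simp add: mult_ac)
next
  case (Suc j)
  have c: "0 \<le> (1 - \<gamma>) ^ j * (norm y)\<^sup>2 / \<sigma>'"
    using margin rate by simp
  have "\<xi> \<bullet> (transition L (Suc j) *v y) = (\<xi> v* L j) \<bullet> (transition L j *v y)"
    by (simp add: dot_lmul_matrix flip: matrix_vector_mul_assoc)
  also have "\<dots>\<^sup>2 \<le> (1 - \<gamma>) ^ j * (norm y)\<^sup>2 / \<sigma>' * q j (\<xi> v* L j)"
    using Suc by simp
  also have "\<dots> \<le> (1 - \<gamma>) ^ j * (norm y)\<^sup>2 / \<sigma>' * ((1 - \<gamma>) * q (Suc j) \<xi>)"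
    using Suc.prems by (intro mult_left_mono quadratic_contraction c) simp
  finally show ?case by (simp add: mult_ac)
qed

lemma norm_transition_le:
  "norm (transition L \<rho> *v y) \<le> \<kappa> * exp (- \<gamma> * real \<rho> / 2) * norm y"
proof -
  let ?y = "transition L \<rho> *v y"
  have pow: "(1 - \<gamma>) ^ \<rho> \<le> exp (- \<gamma> * real \<rho>)"
  proof -
    have "(1 - \<gamma>) ^ \<rho> \<le> exp (- \<gamma>) ^ \<rho>"
      using rate exp_ge_add_one_self[of "- \<gamma>"] by (intro power_mono) simp_all
    then show ?thesis by (simp add: exp_of_nat_mult[symmetric] mult.commute)
  qed
  \<comment> \<open>The dual estimate is tested at the image itself; the left side is then a fourth
    power, and a square cancels.\<close>
  have "((norm ?y)\<^sup>2)\<^sup>2 \<le> (1 - \<gamma>) ^ \<rho> * (norm y)\<^sup>2 / \<sigma>' * q \<rho> ?y"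
    using transition_quadratic[of \<rho> ?y y] by (simp add: power2_norm_eq_inner)
  also have "\<dots> \<le> exp (- \<gamma> * real \<rho>) * (norm y)\<^sup>2 / \<sigma>' * (\<nu> * (norm ?y)\<^sup>2)"
    using pow margin rate
    by (intro mult_mono divide_right_mono contractive_target.state_upper[OF targets] quadratic_nonneg) simp_all
  finally have "(norm ?y)\<^sup>2 * (norm ?y)\<^sup>2 \<le> (\<kappa> * exp (- \<gamma> * real \<rho>) * (norm y)\<^sup>2) * (norm ?y)\<^sup>2"
    by (simp add: power2_eq_square mult_ac)
  then have "(norm ?y)\<^sup>2 \<le> \<kappa> * exp (- \<gamma> * real \<rho>) * (norm y)\<^sup>2"
    using margin by (cases "norm ?y = 0") (simp_all only: mult_le_cancel_right, simp_all)
  \<comment> \<open>Enlarging \<kappa>, which is at least 1, to its square makes the right side the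
    square of the claimed bound.\<close>
  also have "\<dots> \<le> \<kappa>\<^sup>2 * exp (- \<gamma> * real \<rho>) * (norm y)\<^sup>2"
    using rate by (intro mult_right_mono self_le_power) simp_all
  also have "exp (- \<gamma> * real \<rho>) = (exp (- \<gamma> * real \<rho> / 2))\<^sup>2"
    by (simp add: power2_eq_square exp_add[symmetric])
  finally have "(norm ?y)\<^sup>2 \<le> (\<kappa> * exp (- \<gamma> * real \<rho> / 2) * norm y)\<^sup>2"
    by (simp only: power_mult_distrib)
  then show ?thesis
    by (rule power2_le_imp_le) (use margin in simp)
qed

text \<open>\<open>norm_lift_le\<close> bounds the transpose of \<open>feedback\<close>. Pairing the
  vector with itself moves \<open>feedback\<close> to the other side, and one norm cancels.\<close>

lemma norm_mean_le:
  "norm (feedback (gain (S \<rho>)) *v (transition L \<rho> *v y))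
    \<le> (1 + \<kappa>) * \<kappa> * exp (- \<gamma> * real \<rho> / 2) * norm y"
proof -
  let ?y = "transition L \<rho> *v y" and ?K = "gain (S \<rho>)"
  let ?m = "feedback ?K *v ?y"
  obtain a b where ab: "?m = stack a b" by (rule stack_exists)
  have "norm ?m * norm ?m = (stack a b v* feedback ?K) \<bullet> ?y"
    by (simp add: ab dot_lmul_matrix flip: power2_norm_eq_inner power2_eq_square del: feedback_mult)
  also have "\<dots> \<le> norm (a + b v* ?K) * norm ?y"
    unfolding feedback_mult by (rule norm_cauchy_schwarz)
  also have "\<dots> \<le> ((1 + \<kappa>) * norm ?m) * norm ?y"
    unfolding ab by (intro mult_right_mono contractive_target.norm_lift_le[OF targets]) simp_all
  finally have "norm ?m * norm ?m \<le> ((1 + \<kappa>) * norm ?y) * norm ?m"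
    by (simp add: mult_ac)
  then have "norm ?m \<le> (1 + \<kappa>) * norm ?y"
    using margin by (cases "norm ?m = 0") (simp_all only: mult_le_cancel_right, simp_all)
  also have "\<dots> \<le> (1 + \<kappa>) * (\<kappa> * exp (- \<gamma> * real \<rho> / 2) * norm y)"
    by (intro mult_left_mono norm_transition_le) (use margin in simp)
  finally show ?thesis by (simp add: mult.assoc)
qed

text \<open>The factor 1 reproduces itself: one step applied to the state block is dominated by that
  block plus \<eta>, and changing to the next block adds \<zeta>. The excess over 1 is not
  amplified. Additive errors are divided by \<sigma>' to become multiples of the form.\<close>

lemma state_cov_quadratic:
  "j \<le> \<rho> \<Longrightarrow> \<xi> \<bullet> (state_cov L N j *v \<xi>) \<le> (1 + (\<Sum>i<j. \<eta> i + \<zeta>) / \<sigma>') * q j \<xi>"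
proof (induction j arbitrary: \<xi>)
  case 0
  then show ?case by (simp add: quadratic_nonneg)
next
  case (Suc j)
  let ?c = "(\<Sum>i<j. \<eta> i + \<zeta>) / \<sigma>'" and ?e = "\<eta> j + \<zeta>"
  have j: "j < \<rho>" "j \<le> \<rho>" using Suc.prems by simp_all
  have zeta: "0 \<le> \<zeta>" using drift[OF j(1)] opnorm_nonneg order_trans by blast
  have c: "0 \<le> ?c" using j eta zeta margin by (intro divide_nonneg_nonneg sum_nonneg) auto
  have "\<xi> \<bullet> (state_cov L N (Suc j) *v \<xi>) = (\<xi> v* L j) \<bullet> (state_cov L N j *v (\<xi> v* L j))
      + (\<xi> v* B) \<bullet> (input_cov (S j) *v (\<xi> v* B)) + \<xi> \<bullet> (W *v \<xi>)"
    by (simp add: matrix_vector_mult_add_rdistrib inner_add_right inner_congruence)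
  also have "\<dots> \<le> (1 + ?c) * q j (\<xi> v* L j)
      + (\<xi> v* B) \<bullet> (input_cov (S j) *v (\<xi> v* B)) + \<xi> \<bullet> (W *v \<xi>)"
    using Suc j by simp
  also have "\<dots> \<le> ?c * q j (\<xi> v* L j) + q j \<xi> + \<eta> j * (norm \<xi>)\<^sup>2"
    using contractive_target.closed_loop_quadratic[OF targets[OF j(2)], of \<xi>] by (simp add: distrib_right)
  also have "\<dots> \<le> ?c * q (Suc j) \<xi> + q (Suc j) \<xi> + ?e * (norm \<xi>)\<^sup>2"
  proof -
    \<comment> \<open>Of the contraction only a factor at most 1 is kept, so the errors accumulate
      as a plain sum.\<close>
    have "q j (\<xi> v* L j) \<le> (1 - \<gamma>) * q (Suc j) \<xi>"
      by (rule quadratic_contraction[OF j(1)])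
    also have "\<dots> \<le> 1 * q (Suc j) \<xi>"
      using rate Suc.prems by (intro mult_right_mono quadratic_nonneg) simp_all
    finally have "?c * q j (\<xi> v* L j) \<le> ?c * q (Suc j) \<xi>"
      using c by (intro mult_left_mono) simp_all
    then show ?thesis
      using quadratic_drift[OF j(1), of \<xi>] by (simp add: distrib_right)
  qed
  also have "\<dots> \<le> ?c * q (Suc j) \<xi> + q (Suc j) \<xi> + ?e * (q (Suc j) \<xi> / \<sigma>')"
    using j eta[OF j(2)] zeta Suc.prems by (intro add_left_mono mult_left_mono norm_le_quadratic) simp_all
  also have "\<dots> = (1 + (\<Sum>i<Suc j. \<eta> i + \<zeta>) / \<sigma>') * q (Suc j) \<xi>"
    by (simp add: add_divide_distrib distrib_right)
  finally show ?case .
qed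

text \<open>The completed square represents the target with the same gain and the same
  \<open>input_cov\<close>. The input noise therefore cancels, and only state covariance minus state
  block, at the lifted vector, remains.\<close>

lemma cov_excess_le:
  "\<xi> \<bullet> ((feedback (gain (S \<rho>)) ** state_cov L N \<rho> ** transpose (feedback (gain (S \<rho>)))
      + input_inclusion ** input_cov (S \<rho>) ** transpose input_inclusion - S \<rho>) *v \<xi>)
    \<le> (1 + \<kappa>)\<^sup>2 * \<kappa>\<^sup>2 * (\<Sum>i<\<rho>. \<eta> i + \<zeta>) * (norm \<xi>)\<^sup>2"
proof -
  interpret t: contractive_target A B W "S \<rho>" \<sigma>' "\<eta> \<rho>" \<nu> by (rule targets) simp
  let ?K = "gain (S \<rho>)" and ?c = "\<Sum>i<\<rho>. \<eta> i + \<zeta>"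
  have c: "0 \<le> ?c"
    using eta drift opnorm_nonneg by (intro sum_nonneg add_nonneg_nonneg) (auto intro: order_trans)
  obtain a b where ab: "\<xi> = stack a b" by (rule stack_exists)
  let ?a = "a + b v* ?K"
  have "\<xi> \<bullet> ((feedback ?K ** state_cov L N \<rho> ** transpose (feedback ?K)
      + input_inclusion ** input_cov (S \<rho>) ** transpose input_inclusion - S \<rho>) *v \<xi>)
    = ?a \<bullet> (state_cov L N \<rho> *v ?a) - q \<rho> ?a"
    by (simp only: ab matrix_vector_mult_diff_rdistrib matrix_vector_mult_add_rdistrib inner_diff_right
        inner_add_right inner_congruence feedback_mult input_inclusion_mult t.complete_square)
  also have "\<dots> \<le> ?c / \<sigma>' * q \<rho> ?a"
    using state_cov_quadratic[of \<rho> ?a] by (simp add: distrib_right)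
  also have "\<dots> \<le> ?c / \<sigma>' * (\<nu> * (norm ?a)\<^sup>2)"
    using c margin by (intro mult_left_mono t.state_upper) simp
  also have "\<dots> = \<kappa> * ?c * (norm ?a)\<^sup>2" by simp
  \<comment> \<open>The lift contributes \<open>(1 + \<kappa>)\<^sup>2\<close>, and \<kappa> is
    enlarged to its square.\<close>
  also have "\<dots> \<le> \<kappa>\<^sup>2 * ?c * ((1 + \<kappa>) * norm \<xi>)\<^sup>2"
    using c rate t.norm_lift_le[of a b] unfolding ab
    by (intro mult_mono power_mono self_le_power) simp_all
  finally show ?thesis by (simp only: power_mult_distrib mult_ac)
qed

end

section \<open>Conditional laws and conditional expectations\<close>

lemma integrable_mult_bounded:
  fixes f g :: "'a \<Rightarrow> real"
  assumes "integrable M g" "f \<in> borel_measurable M" "\<And>\<omega>. \<omega> \<in> space M \<Longrightarrow> \<bar>f \<omega>\<bar> \<le> c"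
  shows "integrable M (\<lambda>\<omega>. f \<omega> * g \<omega>)"
proof (rule Bochner_Integration.integrable_bound)
  show "integrable M (\<lambda>\<omega>. c * \<bar>g \<omega>\<bar>)" using assms(1) by simp
  show "AE \<omega> in M. norm (f \<omega> * g \<omega>) \<le> norm (c * \<bar>g \<omega>\<bar>)"
  proof (rule AE_I2)
    fix \<omega> assume "\<omega> \<in> space M"
    then have "\<bar>f \<omega>\<bar> * \<bar>g \<omega>\<bar> \<le> \<bar>c\<bar> * \<bar>g \<omega>\<bar>"
      using assms(3)[of \<omega>] by (intro mult_right_mono) auto
    then show "norm (f \<omega> * g \<omega>) \<le> norm (c * \<bar>g \<omega>\<bar>)" by (simp add: abs_mult)
  qed
qed (use assms in measurable)

lemma integrable_mult_squares:
  fixes f g :: "'a \<Rightarrow> real"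
  assumes "integrable M (\<lambda>\<omega>. (f \<omega>)\<^sup>2)" "integrable M (\<lambda>\<omega>. (g \<omega>)\<^sup>2)"
    and [measurable]: "f \<in> borel_measurable M" "g \<in> borel_measurable M"
  shows "integrable M (\<lambda>\<omega>. f \<omega> * g \<omega>)"
proof (rule Bochner_Integration.integrable_bound)
  show "integrable M (\<lambda>\<omega>. (f \<omega>)\<^sup>2 + (g \<omega>)\<^sup>2)" using assms by simp
  have "\<bar>x * y\<bar> \<le> x\<^sup>2 + y\<^sup>2" for x y :: real
    using sum_squares_bound[of x y] sum_squares_bound[of x "-y"] by (auto simp: abs_le_iff)
  then show "AE \<omega> in M. norm (f \<omega> * g \<omega>) \<le> norm ((f \<omega>)\<^sup>2 + (g \<omega>)\<^sup>2)" by simp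
qed measurable

context prob_space
begin

lemma subalgebra_sigma_finite: "subalgebra M G \<Longrightarrow> sigma_finite_subalgebra M G"
  by (intro finite_measure_subalgebra_is_sigma_finite
      finite_measure_subalgebra.intro finite_measure_subalgebra_axioms.intro finite_measure_axioms)

lemma integrable_of_square:
  assumes "integrable M (\<lambda>\<omega>. (f \<omega>)\<^sup>2)" "f \<in> borel_measurable M"
  shows "integrable M (f :: _ \<Rightarrow> real)"
  using integrable_mult_squares[of M f "\<lambda>_. 1"] assms by simp

text \<open>\<open>cond_law\<close> treats one event at a time, with a null set depending on the
  event. Integrating over a set \<open>D\<close> of \<open>H\<close> removes these null sets and
  gives an equality of measures, valid for every nonnegative \<phi>; such integrals characterise the
  conditional expectation.\<close>

lemma nn_cond_exp_cond_law:
  fixes X :: "'a \<Rightarrow> 'b :: topological_space"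
  assumes sub: "subalgebra M H" and [measurable]: "X \<in> borel_measurable M"
    and law: "cond_law M H X \<kappa>" and [measurable]: "\<phi> \<in> borel_measurable borel"
  shows "AE \<omega> in M. nn_cond_exp M H (\<lambda>\<omega>. \<phi> (X \<omega>)) \<omega> = (\<integral>\<^sup>+ y. \<phi> y \<partial>\<kappa> \<omega>)"
proof -
  interpret sigma_finite_subalgebra M H by (rule subalgebra_sigma_finite[OF sub])
  have \<kappa>H [measurable]: "\<kappa> \<in> measurable H (subprob_algebra borel)"
    using law by (auto simp: cond_law_def intro: measurable_prob_algebraD)
  have \<kappa>M: "\<kappa> \<in> measurable M (subprob_algebra borel)"
    by (rule measurable_from_subalg[OF sub \<kappa>H])
  have spH: "space H = space M" using sub by (simp add: subalgebra_def)
  have "(\<integral>\<^sup>+ \<omega>\<in>D. \<phi> (X \<omega>) \<partial>M) = (\<integral>\<^sup>+ \<omega>\<in>D. (\<integral>\<^sup>+ y. \<phi> y \<partial>\<kappa> \<omega>) \<partial>M)" if D: "D \<in> sets H" for D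
  proof -
    have DM [measurable]: "D \<in> sets M" using D sub by (auto simp: subalgebra_def)
    \<comment> \<open>\<open>M\<close> restricted to \<open>D\<close>. Under it the law of
      \<open>X\<close> is shown to be the mixture of the kernel.\<close>
    let ?M = "density M (indicator D)"
    have \<kappa>D: "\<kappa> \<in> measurable ?M (subprob_algebra borel)" using \<kappa>M by simp
    have ne: "space ?M \<noteq> {}" by (simp add: not_empty)
    have eq: "distr ?M borel X = ?M \<bind> \<kappa>"
    proof (rule measure_eqI)
      show "sets (distr ?M borel X) = sets (?M \<bind> \<kappa>)"
        using sets_bind[OF sets_kernel[OF \<kappa>D] ne] by simp
    next
      fix E assume "E \<in> sets (distr ?M borel X)"
      then have E [measurable]: "E \<in> sets borel" by simp
      let ?I = "indicator (X -` E \<inter> space M) :: 'a \<Rightarrow> real"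
      have XE [measurable]: "X -` E \<inter> space M \<in> sets M" by measurable
      have intI: "integrable M ?I"
        by (intro integrable_real_indicator) (auto simp: emeasure_eq_measure)
      have me: "(\<lambda>\<omega>. measure (\<kappa> \<omega>) E) \<in> borel_measurable M"
        using measurable_compose[OF \<kappa>M, of "\<lambda>N. measure N E"] by simp
      have "emeasure (distr ?M borel X) E = emeasure ?M (X -` E \<inter> space M)"
        by (simp add: emeasure_distr)
      also have "\<dots> = (\<integral>\<^sup>+ \<omega>. ennreal (indicator D \<omega> * ?I \<omega>) \<partial>M)"
        by (simp add: emeasure_density) (intro nn_integral_cong, simp add: indicator_def)
      also have "\<dots> = ennreal (\<integral>\<omega>. indicator D \<omega> * ?I \<omega> \<partial>M)"
        using intI
        by (intro nn_integral_eq_integral integrable_mult_bounded[where c = 1]) (auto split: split_indicator)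
      also have "(\<integral>\<omega>. indicator D \<omega> * ?I \<omega> \<partial>M) = (\<integral>\<omega>. indicator D \<omega> * real_cond_exp M H ?I \<omega> \<partial>M)"
        using D intI by (intro real_cond_exp_intg(2)[symmetric] integrable_mult_bounded[where c = 1])
          (auto split: split_indicator)
      also have "\<dots> = (\<integral>\<omega>. indicator D \<omega> * measure (\<kappa> \<omega>) E \<partial>M)"
      proof (rule integral_cong_AE)
        have "AE \<omega> in M. real_cond_exp M H ?I \<omega> = measure (\<kappa> \<omega>) E"
          using law E by (simp add: cond_law_def)
        then show "AE \<omega> in M. indicator D \<omega> * real_cond_exp M H ?I \<omega> = indicator D \<omega> * measure (\<kappa> \<omega>) E"
          by eventually_elim simp
      qed (use me in measurable)
      also have "ennreal \<dots> = (\<integral>\<^sup>+ \<omega>. ennreal (indicator D \<omega> * measure (\<kappa> \<omega>) E) \<partial>M)"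
      proof (intro nn_integral_eq_integral[symmetric] integrable_mult_bounded[where c = 1])
        have "measure (\<kappa> \<omega>) E \<le> 1" if "\<omega> \<in> space M" for \<omega>
          using measurable_space[OF \<kappa>M that] subprob_space.subprob_measure_le_1
          by (auto simp: space_subprob_algebra)
        then show "integrable M (\<lambda>\<omega>. measure (\<kappa> \<omega>) E)"
          using me by (intro integrable_const_bound[where B = 1]) auto
      qed (auto simp: indicator_def)
      also have "\<dots> = (\<integral>\<^sup>+ \<omega>. indicator D \<omega> * emeasure (\<kappa> \<omega>) E \<partial>M)"
      proof (rule nn_integral_cong)
        fix \<omega> assume "\<omega> \<in> space M"
        then interpret subprob_space "\<kappa> \<omega>"
          using measurable_space[OF \<kappa>M] by (auto simp: space_subprob_algebra)
        show "ennreal (indicator D \<omega> * measure (\<kappa> \<omega>) E) = indicator D \<omega> * emeasure (\<kappa> \<omega>) E"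
          by (simp add: ennreal_mult emeasure_eq_measure indicator_def)
      qed
      also have "\<dots> = (\<integral>\<^sup>+ \<omega>. emeasure (\<kappa> \<omega>) E \<partial>?M)"
        using measurable_compose[OF \<kappa>M, of "\<lambda>N. emeasure N E"] by (subst nn_integral_density) auto
      also have "\<dots> = emeasure (?M \<bind> \<kappa>) E"
        using E by (rule emeasure_bind[OF ne \<kappa>D, symmetric])
      finally show "emeasure (distr ?M borel X) E = emeasure (?M \<bind> \<kappa>) E" .
    qed
    have "(\<integral>\<^sup>+ \<omega>\<in>D. \<phi> (X \<omega>) \<partial>M) = (\<integral>\<^sup>+ y. \<phi> y \<partial>distr ?M borel X)"
      by (simp add: nn_integral_distr nn_integral_density mult.commute)
    also have "\<dots> = (\<integral>\<^sup>+ \<omega>. \<integral>\<^sup>+ y. \<phi> y \<partial>\<kappa> \<omega> \<partial>?M)"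
      unfolding eq by (rule nn_integral_bind[OF _ \<kappa>D]) simp
    also have "\<dots> = (\<integral>\<^sup>+ \<omega>\<in>D. (\<integral>\<^sup>+ y. \<phi> y \<partial>\<kappa> \<omega>) \<partial>M)"
      using measurable_compose[OF \<kappa>M nn_integral_measurable_subprob_algebra[of \<phi> borel]]
      by (subst nn_integral_density) (auto simp: mult.commute)
    finally show ?thesis .
  qed
  then have "AE \<omega> in M. (\<integral>\<^sup>+ y. \<phi> y \<partial>\<kappa> \<omega>) = nn_cond_exp M H (\<lambda>\<omega>. \<phi> (X \<omega>)) \<omega>"
    by (rule nn_cond_exp_charact)
      (auto intro: measurable_compose[OF \<kappa>H nn_integral_measurable_subprob_algebra])
  then show ?thesis by (auto simp: eq_commute)
qed

end

section \<open>Moments of centred normal laws\<close>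

lemma nn_integral_normal_law_square:
  assumes "0 \<le> c"
  shows "(\<integral>\<^sup>+ y. ennreal (y\<^sup>2) \<partial>normal_law 0 c) = ennreal c"
proof (cases "c = 0")
  case True
  then show ?thesis by (simp add: normal_law_def nn_integral_return)
next
  case False
  with assms have c: "0 < sqrt c" by simp
  have hb: "has_bochner_integral lborel (\<lambda>y. normal_density 0 (sqrt c) y * y\<^sup>2) c"
    using normal_moment_even[OF c, of 0 1] assms by (simp add: fact_numeral)
  have "(\<integral>\<^sup>+ y. ennreal (y\<^sup>2) \<partial>normal_law 0 c) = (\<integral>\<^sup>+ y. ennreal (normal_density 0 (sqrt c) y * y\<^sup>2) \<partial>lborel)"
    using False by (simp add: normal_law_def nn_integral_density ennreal_mult)
  also have "\<dots> = ennreal c"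
    using nn_integral_eq_integral[OF integrable.intros[OF hb]] has_bochner_integral_integral_eq[OF hb]
    by simp
  finally show ?thesis .
qed

text \<open>Reflection about 0. The vanishing mean is phrased by positive and negative parts because
  \<open>real_cond_exp\<close> is a difference of two nonnegative conditional expectations.\<close>

lemma nn_integral_normal_law_symmetric:
  "(\<integral>\<^sup>+ y. ennreal y \<partial>normal_law 0 c) = (\<integral>\<^sup>+ y. ennreal (- y) \<partial>normal_law 0 c)"
proof (cases "c = 0")
  case True
  then show ?thesis by (simp add: normal_law_def nn_integral_return)
next
  case False
  have "(\<integral>\<^sup>+ y. ennreal (normal_density 0 (sqrt c) y) * ennreal y \<partial>lborel)
    = (\<integral>\<^sup>+ y. ennreal (normal_density 0 (sqrt c) y) * ennreal (- y) \<partial>lborel)"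
    by (subst nn_integral_real_affine[where c = "-1" and t = 0]) (simp_all add: normal_density_def)
  then show ?thesis
    using False by (simp add: normal_law_def nn_integral_density)
qed

lemma nn_integral_mvnormal:
  assumes N: "is_mvnormal N 0 C"
  shows "(\<integral>\<^sup>+ y. ennreal ((\<xi> \<bullet> y)\<^sup>2) \<partial>N) = ennreal (\<xi> \<bullet> (C *v \<xi>))"
    "(\<integral>\<^sup>+ y. ennreal (\<xi> \<bullet> y) \<partial>N) = (\<integral>\<^sup>+ y. ennreal (- (\<xi> \<bullet> y)) \<partial>N)"
proof -
  have [measurable_cong]: "sets N = sets borel" using N by (simp add: is_mvnormal_def)
  have d: "distr N borel (\<lambda>y. \<xi> \<bullet> y) = normal_law 0 (\<xi> \<bullet> (C *v \<xi>))" "0 \<le> \<xi> \<bullet> (C *v \<xi>)"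
    using N by (simp_all add: is_mvnormal_def psd_def)
  have *: "(\<integral>\<^sup>+ y. f (\<xi> \<bullet> y) \<partial>N) = (\<integral>\<^sup>+ y. f y \<partial>normal_law 0 (\<xi> \<bullet> (C *v \<xi>)))"
    if [measurable]: "f \<in> borel_measurable borel" for f :: "real \<Rightarrow> ennreal"
    unfolding d(1)[symmetric] by (subst nn_integral_distr) simp_all
  show "(\<integral>\<^sup>+ y. ennreal ((\<xi> \<bullet> y)\<^sup>2) \<partial>N) = ennreal (\<xi> \<bullet> (C *v \<xi>))"
    using *[of "\<lambda>y. ennreal (y\<^sup>2)"] nn_integral_normal_law_square[OF d(2)] by simp
  show "(\<integral>\<^sup>+ y. ennreal (\<xi> \<bullet> y) \<partial>N) = (\<integral>\<^sup>+ y. ennreal (- (\<xi> \<bullet> y)) \<partial>N)"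
    using *[of ennreal] *[of "\<lambda>y. ennreal (- y)"] nn_integral_normal_law_symmetric by simp
qed

context prob_space
begin

text \<open>No integrability is needed: \<^const>\<open>real_cond_exp\<close> is defined from \<^const>\<open>nn_cond_exp\<close>, for which multiplication
  by an indicator is unconditional.\<close>

lemma real_cond_exp_local:
  assumes sub: "subalgebra M G" and E: "E \<in> sets G"
    and [measurable]: "f \<in> borel_measurable M" "g \<in> borel_measurable M"
    and eq: "AE \<omega> in M. \<omega> \<in> E \<longrightarrow> f \<omega> = g \<omega>"
  shows "AE \<omega> in M. \<omega> \<in> E \<longrightarrow> real_cond_exp M G f \<omega> = real_cond_exp M G g \<omega>"
proof -
  interpret sigma_finite_subalgebra M G by (rule subalgebra_sigma_finite[OF sub])
  have [measurable]: "E \<in> sets M" "E \<in> sets G" using sub E by (auto simp: subalgebra_def)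
  have nn: "AE \<omega> in M. \<omega> \<in> E \<longrightarrow> nn_cond_exp M G f' \<omega> = nn_cond_exp M G g' \<omega>"
    if [measurable]: "f' \<in> borel_measurable M" "g' \<in> borel_measurable M"
      and "AE \<omega> in M. \<omega> \<in> E \<longrightarrow> f' \<omega> = g' \<omega>" for f' g' :: "'a \<Rightarrow> ennreal"
  proof -
    have "AE \<omega> in M. nn_cond_exp M G (\<lambda>\<omega>. indicator E \<omega> * f' \<omega>) \<omega> = nn_cond_exp M G (\<lambda>\<omega>. indicator E \<omega> * g' \<omega>) \<omega>"
      using that(3) by (intro nn_cond_exp_cong) (auto simp: indicator_def)
    moreover have "AE \<omega> in M. indicator E \<omega> * nn_cond_exp M G f' \<omega> = nn_cond_exp M G (\<lambda>\<omega>. indicator E \<omega> * f' \<omega>) \<omega>"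
      by (rule nn_cond_exp_prod) measurable
    moreover have "AE \<omega> in M. indicator E \<omega> * nn_cond_exp M G g' \<omega> = nn_cond_exp M G (\<lambda>\<omega>. indicator E \<omega> * g' \<omega>) \<omega>"
      by (rule nn_cond_exp_prod) measurable
    ultimately show ?thesis by eventually_elim (auto simp: indicator_def)
  qed
  have "AE \<omega> in M. \<omega> \<in> E \<longrightarrow> nn_cond_exp M G (\<lambda>\<omega>. ennreal (f \<omega>)) \<omega> = nn_cond_exp M G (\<lambda>\<omega>. ennreal (g \<omega>)) \<omega>"
    using eq by (intro nn) auto
  moreover have "AE \<omega> in M. \<omega> \<in> E \<longrightarrow> nn_cond_exp M G (\<lambda>\<omega>. ennreal (- f \<omega>)) \<omega> = nn_cond_exp M G (\<lambda>\<omega>. ennreal (- g \<omega>)) \<omega>"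
    using eq by (intro nn) auto
  ultimately show ?thesis by eventually_elim (auto simp: real_cond_exp_def)
qed

text \<open>Puts the process noise, described by independence, into the same form as the input
  noise, with a constant kernel.\<close>

lemma cond_law_indep:
  fixes X :: "'a \<Rightarrow> 'b :: topological_space"
  assumes sub: "subalgebra M H" and [measurable]: "X \<in> borel_measurable M"
    and ind: "indep_set (sets H) (generated_sets M X)"
  shows "cond_law M H X (\<lambda>_. distr M borel X)"
  unfolding cond_law_def
proof (intro conjI ballI)
  interpret sigma_finite_subalgebra M H by (rule subalgebra_sigma_finite[OF sub])
  show "(\<lambda>_. distr M borel X) \<in> measurable H (prob_algebra borel)"
    by (intro measurable_const) (simp add: space_prob_algebra prob_space_distr)
  fix E :: "'b set" assume [measurable]: "E \<in> sets borel"
  let ?I = "X -` E \<inter> space M"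
  have I [measurable]: "?I \<in> sets M" by measurable
  show "AE \<omega> in M. real_cond_exp M H (indicator ?I) \<omega> = measure (distr M borel X) E"
  proof (rule real_cond_exp_charact)
    fix D assume D: "D \<in> sets H"
    then have [measurable]: "D \<in> sets M" using sub by (auto simp: subalgebra_def)
    have "?I \<in> generated_sets M X"
      by (auto simp: sets_vimage_algebra2)
    then have "prob (D \<inter> ?I) = prob D * prob ?I"
      using ind D by (auto dest: indep_setD)
    then show "(\<integral>\<omega>\<in>D. indicator ?I \<omega> \<partial>M) = (\<integral>\<omega>\<in>D. measure (distr M borel X) E \<partial>M)"
      by (simp add: set_lebesgue_integral_def measure_distr indicator_inter_arith[symmetric] mult.commute)
  next
    show "integrable M (indicator ?I :: 'a \<Rightarrow> real)"
      by (intro integrable_real_indicator) (auto simp: emeasure_eq_measure)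
  qed auto
qed

end

section \<open>Centred random vectors with given conditional covariance\<close>

text \<open>Square integrability is built in because \<^const>\<open>real_cond_exp\<close> has junk values on functions that
  are not integrable. The initial state and the inputs need not be integrable, so the calculus is applied
  after truncation to an event of the past.\<close>

definition centered_cov :: "'a measure \<Rightarrow> 'a measure \<Rightarrow> ('a \<Rightarrow> real ^ 'k) \<Rightarrow> ('a \<Rightarrow> real ^ 'k ^ 'k) \<Rightarrow> bool" where
  "centered_cov M G e S \<longleftrightarrow>
    (\<forall>i. (\<lambda>\<omega>. e \<omega> $ i) \<in> borel_measurable M \<and> integrable M (\<lambda>\<omega>. (e \<omega> $ i)\<^sup>2) \<and>
      (AE \<omega> in M. real_cond_exp M G (\<lambda>\<omega>. e \<omega> $ i) \<omega> = 0)) \<and>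
    (\<forall>i j. AE \<omega> in M. real_cond_exp M G (\<lambda>\<omega>. e \<omega> $ i * e \<omega> $ j) \<omega> = S \<omega> $ i $ j)"

lemma centered_covI:
  assumes "\<And>i. (\<lambda>\<omega>. e \<omega> $ i) \<in> borel_measurable M" "\<And>i. integrable M (\<lambda>\<omega>. (e \<omega> $ i)\<^sup>2)"
    "\<And>i. AE \<omega> in M. real_cond_exp M G (\<lambda>\<omega>. e \<omega> $ i) \<omega> = 0"
    "\<And>i j. AE \<omega> in M. real_cond_exp M G (\<lambda>\<omega>. e \<omega> $ i * e \<omega> $ j) \<omega> = S \<omega> $ i $ j"
  shows "centered_cov M G e S"
  using assms by (simp add: centered_cov_def)

lemma centered_covD:
  assumes "centered_cov M G e S"
  shows "(\<lambda>\<omega>. e \<omega> $ i) \<in> borel_measurable M" "integrable M (\<lambda>\<omega>. (e \<omega> $ i)\<^sup>2)"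
    "AE \<omega> in M. real_cond_exp M G (\<lambda>\<omega>. e \<omega> $ i) \<omega> = 0"
    "AE \<omega> in M. real_cond_exp M G (\<lambda>\<omega>. e \<omega> $ i * e \<omega> $ j) \<omega> = S \<omega> $ i $ j"
    "integrable M (\<lambda>\<omega>. e \<omega> $ i * e \<omega> $ j)"
  using assms by (auto simp: centered_cov_def intro!: integrable_mult_squares)

context prob_space
begin

lemma centered_cov_zero: "subalgebra M G \<Longrightarrow> centered_cov M G (\<lambda>_. 0) (\<lambda>_. 0)"
  using sigma_finite_subalgebra.real_cond_exp_F_meas[OF subalgebra_sigma_finite, of G "\<lambda>_. 0"]
  by (intro centered_covI) auto

lemma centered_cov_integrable: "centered_cov M G e S \<Longrightarrow> integrable M (\<lambda>\<omega>. e \<omega> $ i)"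
  by (rule integrable_of_square) (rule centered_covD; assumption)+

text \<open>Coefficients known to \<open>G\<close> pull out of the conditional expectation; their
  bound keeps all products integrable.\<close>

lemma centered_cov_linear:
  fixes e :: "'a \<Rightarrow> real ^ 'k" and P :: "'a \<Rightarrow> real ^ 'k ^ 'l"
  assumes sub: "subalgebra M G" and e: "centered_cov M G e S"
    and P: "\<And>i k. (\<lambda>\<omega>. P \<omega> $ i $ k) \<in> borel_measurable G"
    and bd: "\<And>\<omega> i k. \<omega> \<in> space M \<Longrightarrow> \<bar>P \<omega> $ i $ k\<bar> \<le> c"
  shows "centered_cov M G (\<lambda>\<omega>. P \<omega> *v e \<omega>) (\<lambda>\<omega>. P \<omega> ** S \<omega> ** transpose (P \<omega>))"
proof -
  interpret sigma_finite_subalgebra M G by (rule subalgebra_sigma_finite[OF sub])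
  note PG [measurable] = P
  note [measurable] = measurable_from_subalg[OF sub P] centered_covD(1)[OF e]
  have comp: "(P \<omega> *v e \<omega>) $ i = (\<Sum>k\<in>UNIV. P \<omega> $ i $ k * e \<omega> $ k)" for \<omega> i
    by (simp add: matrix_vector_mult_def)
  have prod: "(P \<omega> *v e \<omega>) $ i * (P \<omega> *v e \<omega>) $ j =
    (\<Sum>k\<in>UNIV. \<Sum>l\<in>UNIV. (P \<omega> $ i $ k * P \<omega> $ j $ l) * (e \<omega> $ k * e \<omega> $ l))" for \<omega> i j
    by (simp add: comp sum_product mult_ac)
  have bd2: "\<bar>P \<omega> $ i $ k * P \<omega> $ j $ l\<bar> \<le> c * c" if "\<omega> \<in> space M" for \<omega> i j k l
    unfolding abs_mult using order_trans[OF abs_ge_zero bd[OF that, of i k]]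
    by (intro mult_mono bd that) simp_all
  have int1: "integrable M (\<lambda>\<omega>. P \<omega> $ i $ k * e \<omega> $ k)" for i k
    by (intro integrable_mult_bounded[where c = c] centered_cov_integrable[OF e] bd) auto
  have int2: "integrable M (\<lambda>\<omega>. (P \<omega> $ i $ k * P \<omega> $ j $ l) * (e \<omega> $ k * e \<omega> $ l))" for i j k l
    by (intro integrable_mult_bounded[where c = "c * c"] centered_covD[OF e] bd2) auto
  show ?thesis
  proof (rule centered_covI)
    show "(\<lambda>\<omega>. (P \<omega> *v e \<omega>) $ i) \<in> borel_measurable M" for i
      unfolding comp by measurable
    show "integrable M (\<lambda>\<omega>. ((P \<omega> *v e \<omega>) $ i)\<^sup>2)" for i
      unfolding power2_eq_square prod using int2 by simp
    show "AE \<omega> in M. real_cond_exp M G (\<lambda>\<omega>. (P \<omega> *v e \<omega>) $ i) \<omega> = 0" for i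
    proof -
      have "AE \<omega> in M. real_cond_exp M G (\<lambda>\<omega>. \<Sum>k\<in>UNIV. P \<omega> $ i $ k * e \<omega> $ k) \<omega> =
          (\<Sum>k\<in>UNIV. real_cond_exp M G (\<lambda>\<omega>. P \<omega> $ i $ k * e \<omega> $ k) \<omega>)"
        by (rule real_cond_exp_sum) (rule int1)
      moreover have "AE \<omega> in M. \<forall>k. real_cond_exp M G (\<lambda>\<omega>. P \<omega> $ i $ k * e \<omega> $ k) \<omega> =
          P \<omega> $ i $ k * real_cond_exp M G (\<lambda>\<omega>. e \<omega> $ k) \<omega>"
        unfolding AE_all_countable by (intro allI real_cond_exp_mult int1) auto
      moreover have "AE \<omega> in M. \<forall>k. real_cond_exp M G (\<lambda>\<omega>. e \<omega> $ k) \<omega> = 0"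
        unfolding AE_all_countable by (intro allI centered_covD[OF e])
      ultimately show ?thesis
        unfolding comp by eventually_elim simp
    qed
    show "AE \<omega> in M. real_cond_exp M G (\<lambda>\<omega>. (P \<omega> *v e \<omega>) $ i * (P \<omega> *v e \<omega>) $ j) \<omega> =
        (P \<omega> ** S \<omega> ** transpose (P \<omega>)) $ i $ j" for i j
    proof -
      let ?f = "\<lambda>k l \<omega>. (P \<omega> $ i $ k * P \<omega> $ j $ l) * (e \<omega> $ k * e \<omega> $ l)"
      have "AE \<omega> in M. real_cond_exp M G (\<lambda>\<omega>. \<Sum>k\<in>UNIV. \<Sum>l\<in>UNIV. ?f k l \<omega>) \<omega> =
          (\<Sum>k\<in>UNIV. real_cond_exp M G (\<lambda>\<omega>. \<Sum>l\<in>UNIV. ?f k l \<omega>) \<omega>)"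
        by (rule real_cond_exp_sum) (intro Bochner_Integration.integrable_sum int2)
      moreover have "AE \<omega> in M. \<forall>k. real_cond_exp M G (\<lambda>\<omega>. \<Sum>l\<in>UNIV. ?f k l \<omega>) \<omega> =
          (\<Sum>l\<in>UNIV. real_cond_exp M G (?f k l) \<omega>)"
        unfolding AE_all_countable by (intro allI real_cond_exp_sum int2)
      moreover have "AE \<omega> in M. \<forall>k l. real_cond_exp M G (?f k l) \<omega> =
          (P \<omega> $ i $ k * P \<omega> $ j $ l) * real_cond_exp M G (\<lambda>\<omega>. e \<omega> $ k * e \<omega> $ l) \<omega>"
        unfolding AE_all_countable by (intro allI real_cond_exp_mult int2) auto
      moreover have "AE \<omega> in M. \<forall>k l. real_cond_exp M G (\<lambda>\<omega>. e \<omega> $ k * e \<omega> $ l) \<omega> = S \<omega> $ k $ l"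
        unfolding AE_all_countable by (intro allI centered_covD[OF e])
      ultimately show ?thesis
        unfolding prod
      proof eventually_elim
        case (elim \<omega>)
        have "(P \<omega> ** S \<omega> ** transpose (P \<omega>)) $ i $ j =
            (\<Sum>l\<in>UNIV. \<Sum>k\<in>UNIV. P \<omega> $ i $ k * S \<omega> $ k $ l * P \<omega> $ j $ l)"
          by (simp add: matrix_matrix_mult_def transpose_def sum_distrib_right)
        also have "\<dots> = (\<Sum>k\<in>UNIV. \<Sum>l\<in>UNIV. (P \<omega> $ i $ k * P \<omega> $ j $ l) * S \<omega> $ k $ l)"
          by (subst sum.swap) (simp add: mult_ac)
        finally show ?case using elim by simp
      qed
    qed
  qed
qed

text \<open>The tower property: the covariance given \<open>H\<close> is already known to
  \<open>G\<close>, so conditioning once more leaves it unchanged.\<close>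

lemma centered_cov_coarsen:
  assumes sub: "subalgebra M H" "subalgebra H G" and V: "centered_cov M H V C"
    and C: "\<And>i j. (\<lambda>\<omega>. C \<omega> $ i $ j) \<in> borel_measurable G"
  shows "centered_cov M G V C"
proof -
  have subG: "subalgebra M G" using sub by (auto simp: subalgebra_def)
  interpret G: sigma_finite_subalgebra M G by (rule subalgebra_sigma_finite[OF subG])
  interpret H: sigma_finite_subalgebra M H by (rule subalgebra_sigma_finite[OF sub(1)])
  note [measurable] = centered_covD(1)[OF V] C measurable_from_subalg[OF subG C]
  have tower: "AE \<omega> in M. real_cond_exp M G f \<omega> = g \<omega>"
    if f: "integrable M f" and g [measurable]: "g \<in> borel_measurable G"
      and eq: "AE \<omega> in M. real_cond_exp M H f \<omega> = g \<omega>" for f g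
  proof -
    note [measurable] = measurable_from_subalg[OF subG g]
    \<comment> \<open>\<open>g\<close> inherits integrability from the finer conditional expectation
      with which it agrees almost everywhere.\<close>
    have "integrable M (real_cond_exp M H f)" using f by (rule H.real_cond_exp_int(1))
    then have "integrable M g" using eq integrable_cong_AE[of "real_cond_exp M H f" M g] by simp
    then have "AE \<omega> in M. real_cond_exp M G g \<omega> = g \<omega>" using g by (rule G.real_cond_exp_F_meas)
    moreover have "AE \<omega> in M. real_cond_exp M G (real_cond_exp M H f) \<omega> = real_cond_exp M G g \<omega>"
      using eq by (intro G.real_cond_exp_cong) auto
    moreover have "AE \<omega> in M. real_cond_exp M G (real_cond_exp M H f) \<omega> = real_cond_exp M G f \<omega>"
      by (rule G.real_cond_exp_nested_subalg[OF sub f])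
    ultimately show ?thesis by eventually_elim simp
  qed
  show ?thesis
  proof (rule centered_covI)
    show "AE \<omega> in M. real_cond_exp M G (\<lambda>\<omega>. V \<omega> $ i) \<omega> = 0" for i
      by (rule tower[OF centered_cov_integrable[OF V] _ centered_covD(3)[OF V]]) simp
    show "AE \<omega> in M. real_cond_exp M G (\<lambda>\<omega>. V \<omega> $ i * V \<omega> $ j) \<omega> = C \<omega> $ i $ j" for i j
      by (rule tower[OF centered_covD(5)[OF V] C centered_covD(4)[OF V]])
  qed (auto intro: centered_covD[OF V])
qed

text \<open>The cross terms vanish: \<open>e\<close> is known to \<open>H\<close> and
  \<open>V\<close> is centred given \<open>H\<close>, so their product has mean zero given
  \<open>H\<close> and hence given \<open>G\<close>.\<close>

lemma centered_cov_add:
  assumes sub: "subalgebra M H" "subalgebra H G"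
    and e: "centered_cov M G e S" and eH: "\<And>i. (\<lambda>\<omega>. e \<omega> $ i) \<in> borel_measurable H"
    and V: "centered_cov M H V C" and C: "\<And>i j. (\<lambda>\<omega>. C \<omega> $ i $ j) \<in> borel_measurable G"
  shows "centered_cov M G (\<lambda>\<omega>. e \<omega> + V \<omega>) (\<lambda>\<omega>. S \<omega> + C \<omega>)"
proof -
  have subG: "subalgebra M G" using sub by (auto simp: subalgebra_def)
  interpret G: sigma_finite_subalgebra M G by (rule subalgebra_sigma_finite[OF subG])
  interpret H: sigma_finite_subalgebra M H by (rule subalgebra_sigma_finite[OF sub(1)])
  note [measurable] = centered_covD(1)[OF V] centered_covD(1)[OF e]
  have V': "centered_cov M G V C" by (rule centered_cov_coarsen[OF sub V C])
  have intc: "integrable M (\<lambda>\<omega>. e \<omega> $ i * V \<omega> $ j)" for i j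
    by (intro integrable_mult_squares centered_covD[OF e] centered_covD[OF V])
  have cross: "AE \<omega> in M. real_cond_exp M G (\<lambda>\<omega>. e \<omega> $ i * V \<omega> $ j) \<omega> = 0" for i j
  proof -
    have "AE \<omega> in M. real_cond_exp M H (\<lambda>\<omega>. e \<omega> $ i * V \<omega> $ j) \<omega> = e \<omega> $ i * real_cond_exp M H (\<lambda>\<omega>. V \<omega> $ j) \<omega>"
      by (intro H.real_cond_exp_mult eH intc) auto
    then have "AE \<omega> in M. real_cond_exp M H (\<lambda>\<omega>. e \<omega> $ i * V \<omega> $ j) \<omega> = 0"
      using centered_covD(3)[OF V, of j] by eventually_elim simp
    then have "AE \<omega> in M. real_cond_exp M G (real_cond_exp M H (\<lambda>\<omega>. e \<omega> $ i * V \<omega> $ j)) \<omega> = real_cond_exp M G (\<lambda>_. 0) \<omega>"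
      by (intro G.real_cond_exp_cong) auto
    moreover have "AE \<omega> in M. real_cond_exp M G (real_cond_exp M H (\<lambda>\<omega>. e \<omega> $ i * V \<omega> $ j)) \<omega> =
        real_cond_exp M G (\<lambda>\<omega>. e \<omega> $ i * V \<omega> $ j) \<omega>"
      by (rule G.real_cond_exp_nested_subalg[OF sub intc])
    moreover have "AE \<omega> in M. real_cond_exp M G (\<lambda>_. 0) \<omega> = 0"
      by (rule G.real_cond_exp_F_meas) auto
    ultimately show ?thesis by eventually_elim simp
  qed
  have prod: "(e \<omega> + V \<omega>) $ i * (e \<omega> + V \<omega>) $ j =
      (e \<omega> $ i * e \<omega> $ j + V \<omega> $ i * V \<omega> $ j) + (e \<omega> $ i * V \<omega> $ j + e \<omega> $ j * V \<omega> $ i)" for \<omega> i j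
    by (simp add: algebra_simps)
  show ?thesis
  proof (rule centered_covI)
    show "(\<lambda>\<omega>. (e \<omega> + V \<omega>) $ i) \<in> borel_measurable M" for i by simp
    show "integrable M (\<lambda>\<omega>. ((e \<omega> + V \<omega>) $ i)\<^sup>2)" for i
      unfolding power2_eq_square prod
      by (intro Bochner_Integration.integrable_add intc centered_covD[OF e] centered_covD[OF V])
    show "AE \<omega> in M. real_cond_exp M G (\<lambda>\<omega>. (e \<omega> + V \<omega>) $ i) \<omega> = 0" for i
    proof -
      have "AE \<omega> in M. real_cond_exp M G (\<lambda>\<omega>. e \<omega> $ i + V \<omega> $ i) \<omega> =
          real_cond_exp M G (\<lambda>\<omega>. e \<omega> $ i) \<omega> + real_cond_exp M G (\<lambda>\<omega>. V \<omega> $ i) \<omega>"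
        by (intro G.real_cond_exp_add centered_cov_integrable[OF e] centered_cov_integrable[OF V])
      then show ?thesis
        using centered_covD(3)[OF e, of i] centered_covD(3)[OF V', of i]
        by eventually_elim simp
    qed
    show "AE \<omega> in M. real_cond_exp M G (\<lambda>\<omega>. (e \<omega> + V \<omega>) $ i * (e \<omega> + V \<omega>) $ j) \<omega> = (S \<omega> + C \<omega>) $ i $ j" for i j
    proof -
      have "AE \<omega> in M. real_cond_exp M G (\<lambda>\<omega>. (e \<omega> + V \<omega>) $ i * (e \<omega> + V \<omega>) $ j) \<omega> =
          real_cond_exp M G (\<lambda>\<omega>. e \<omega> $ i * e \<omega> $ j + V \<omega> $ i * V \<omega> $ j) \<omega> +
          real_cond_exp M G (\<lambda>\<omega>. e \<omega> $ i * V \<omega> $ j + e \<omega> $ j * V \<omega> $ i) \<omega>"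
        unfolding prod
        by (intro G.real_cond_exp_add Bochner_Integration.integrable_add intc centered_covD[OF e] centered_covD[OF V])
      moreover have "AE \<omega> in M. real_cond_exp M G (\<lambda>\<omega>. e \<omega> $ i * e \<omega> $ j + V \<omega> $ i * V \<omega> $ j) \<omega> =
          real_cond_exp M G (\<lambda>\<omega>. e \<omega> $ i * e \<omega> $ j) \<omega> + real_cond_exp M G (\<lambda>\<omega>. V \<omega> $ i * V \<omega> $ j) \<omega>"
        by (intro G.real_cond_exp_add centered_covD[OF e] centered_covD[OF V])
      moreover have "AE \<omega> in M. real_cond_exp M G (\<lambda>\<omega>. e \<omega> $ i * V \<omega> $ j + e \<omega> $ j * V \<omega> $ i) \<omega> =
          real_cond_exp M G (\<lambda>\<omega>. e \<omega> $ i * V \<omega> $ j) \<omega> + real_cond_exp M G (\<lambda>\<omega>. e \<omega> $ j * V \<omega> $ i) \<omega>"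
        by (intro G.real_cond_exp_add intc)
      ultimately show ?thesis
        using centered_covD(4)[OF e, of i j] centered_covD(4)[OF V', of i j] cross[of i j] cross[of j i]
        by eventually_elim simp
    qed
  qed
qed

text \<open>The first claim uses \<open>nn_cond_exp\<close> so as to hold before integrability is
  known, which it later supplies. The mean is 0 as a difference of equal parts, whatever their
  common value.\<close>

lemma real_cond_exp_mvnormal:
  fixes X :: "'a \<Rightarrow> real ^ 'k"
  assumes sub: "subalgebra M H" and X [measurable]: "X \<in> borel_measurable M"
    and law: "cond_law M H X \<kappa>" and normal: "AE \<omega> in M. is_mvnormal (\<kappa> \<omega>) 0 (C \<omega>)"
  shows "AE \<omega> in M. nn_cond_exp M H (\<lambda>\<omega>. ennreal ((\<xi> \<bullet> X \<omega>)\<^sup>2)) \<omega> = ennreal (\<xi> \<bullet> (C \<omega> *v \<xi>))"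
    "AE \<omega> in M. real_cond_exp M H (\<lambda>\<omega>. (\<xi> \<bullet> X \<omega>)\<^sup>2) \<omega> = \<xi> \<bullet> (C \<omega> *v \<xi>)"
    "AE \<omega> in M. real_cond_exp M H (\<lambda>\<omega>. \<xi> \<bullet> X \<omega>) \<omega> = 0"
proof -
  interpret sigma_finite_subalgebra M H by (rule subalgebra_sigma_finite[OF sub])
  note nn = nn_cond_exp_cond_law[OF sub X law]
  show sq: "AE \<omega> in M. nn_cond_exp M H (\<lambda>\<omega>. ennreal ((\<xi> \<bullet> X \<omega>)\<^sup>2)) \<omega> = ennreal (\<xi> \<bullet> (C \<omega> *v \<xi>))"
  proof -
    have "AE \<omega> in M. nn_cond_exp M H (\<lambda>\<omega>. ennreal ((\<xi> \<bullet> X \<omega>)\<^sup>2)) \<omega> = (\<integral>\<^sup>+ y. ennreal ((\<xi> \<bullet> y)\<^sup>2) \<partial>\<kappa> \<omega>)"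
      by (rule nn) measurable
    then show ?thesis
      using normal by eventually_elim (simp add: nn_integral_mvnormal(1))
  qed
  have neg: "ennreal (- (\<xi> \<bullet> X \<omega>)\<^sup>2) = 0" for \<omega>
    by (simp add: ennreal_neg)
  have "AE \<omega> in M. 0 = nn_cond_exp M H (\<lambda>_. 0) \<omega>"
    by (rule nn_cond_exp_F_meas) simp
  with sq normal show "AE \<omega> in M. real_cond_exp M H (\<lambda>\<omega>. (\<xi> \<bullet> X \<omega>)\<^sup>2) \<omega> = \<xi> \<bullet> (C \<omega> *v \<xi>)"
    unfolding real_cond_exp_def neg
    by eventually_elim (simp add: is_mvnormal_def psd_def)
  show "AE \<omega> in M. real_cond_exp M H (\<lambda>\<omega>. \<xi> \<bullet> X \<omega>) \<omega> = 0"
  proof -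
    have "AE \<omega> in M. nn_cond_exp M H (\<lambda>\<omega>. ennreal (\<xi> \<bullet> X \<omega>)) \<omega> = (\<integral>\<^sup>+ y. ennreal (\<xi> \<bullet> y) \<partial>\<kappa> \<omega>)"
      by (rule nn) measurable
    moreover have "AE \<omega> in M. nn_cond_exp M H (\<lambda>\<omega>. ennreal (- (\<xi> \<bullet> X \<omega>))) \<omega> = (\<integral>\<^sup>+ y. ennreal (- (\<xi> \<bullet> y)) \<partial>\<kappa> \<omega>)"
      by (rule nn) measurable
    ultimately show ?thesis
      using normal unfolding real_cond_exp_def by eventually_elim (simp add: nn_integral_mvnormal(2))
  qed
qed

text \<open>Normality is given by one-dimensional projections, so mixed moments come by
  polarisation. The diagonal bound on \<open>E\<close> makes the truncated second moments
  finite.\<close>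

lemma centered_cov_mvnormal:
  fixes X :: "'a \<Rightarrow> real ^ 'k"
  assumes sub: "subalgebra M H" and X [measurable]: "X \<in> borel_measurable M"
    and law: "cond_law M H X \<kappa>" and normal: "AE \<omega> in M. is_mvnormal (\<kappa> \<omega>) 0 (C \<omega>)"
    and E: "E \<in> sets H" and bd: "\<And>\<omega> i. \<omega> \<in> E \<Longrightarrow> C \<omega> $ i $ i \<le> c"
  shows "centered_cov M H (\<lambda>\<omega>. indicator E \<omega> *\<^sub>R X \<omega>) (\<lambda>\<omega>. indicator E \<omega> *\<^sub>R C \<omega>)"
proof -
  interpret sigma_finite_subalgebra M H by (rule subalgebra_sigma_finite[OF sub])
  have [measurable]: "E \<in> sets M" "E \<in> sets H" using sub E by (auto simp: subalgebra_def)
  let ?I = "indicator E :: 'a \<Rightarrow> real"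
  have [measurable]: "(\<lambda>\<omega>. X \<omega> $ i) \<in> borel_measurable M" for i
    by (rule measurable_compose[OF X borel_measurable_nth])
  note moments = real_cond_exp_mvnormal[OF sub X law normal]
  have ax: "axis i 1 \<bullet> y = y $ i" for i and y :: "real ^ 'k"
    by (simp add: inner_axis')
  have Cax: "(P *v axis j 1) $ i = P $ i $ j" for P :: "real ^ 'k ^ 'k" and i j
    by (simp add: matrix_vector_mul_component inner_axis)
  have sqint: "integrable M (\<lambda>\<omega>. (?I \<omega> * X \<omega> $ i)\<^sup>2)" for i
  proof (rule integrableI_bounded)
    have "(\<integral>\<^sup>+ \<omega>. ennreal (norm ((?I \<omega> * X \<omega> $ i)\<^sup>2)) \<partial>M) = (\<integral>\<^sup>+ \<omega>. indicator E \<omega> * ennreal ((X \<omega> $ i)\<^sup>2) \<partial>M)"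
      by (intro nn_integral_cong) (simp add: indicator_def)
    also have "\<dots> = (\<integral>\<^sup>+ \<omega>. indicator E \<omega> * nn_cond_exp M H (\<lambda>\<omega>. ennreal ((X \<omega> $ i)\<^sup>2)) \<omega> \<partial>M)"
      by (intro nn_cond_exp_intg[symmetric]) auto
    \<comment> \<open>On \<open>E\<close> the conditional second moment is a diagonal entry of
      \<open>C\<close>, at most \<open>c\<close>; elsewhere the indicator is 0.\<close>
    also have "\<dots> \<le> (\<integral>\<^sup>+ \<omega>. ennreal c \<partial>M)"
      using moments(1)[of "axis i 1"] unfolding ax Cax
      by (intro nn_integral_mono_AE, eventually_elim) (auto simp: indicator_def intro!: ennreal_leI bd)
    also have "\<dots> < \<infinity>" by (simp add: emeasure_space_1)
    finally show "(\<integral>\<^sup>+ \<omega>. ennreal (norm ((?I \<omega> * X \<omega> $ i)\<^sup>2)) \<partial>M) < \<infinity>" .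
  qed measurable
  have int2: "integrable M (\<lambda>\<omega>. ?I \<omega> * (X \<omega> $ i * X \<omega> $ j))" for i j
  proof -
    have "integrable M (\<lambda>\<omega>. (?I \<omega> * X \<omega> $ i) * (?I \<omega> * X \<omega> $ j))"
      by (intro integrable_mult_squares sqint) measurable
    also have "(\<lambda>\<omega>. (?I \<omega> * X \<omega> $ i) * (?I \<omega> * X \<omega> $ j)) = (\<lambda>\<omega>. ?I \<omega> * (X \<omega> $ i * X \<omega> $ j))"
      by (simp add: fun_eq_iff indicator_def)
    finally show ?thesis .
  qed
  show ?thesis
  proof (rule centered_covI)
    fix i j
    show "(\<lambda>\<omega>. (?I \<omega> *\<^sub>R X \<omega>) $ i) \<in> borel_measurable M" by simp
    show "integrable M (\<lambda>\<omega>. ((?I \<omega> *\<^sub>R X \<omega>) $ i)\<^sup>2)" using sqint[of i] by simp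
    have "AE \<omega> in M. real_cond_exp M H (\<lambda>\<omega>. ?I \<omega> * X \<omega> $ i) \<omega> = ?I \<omega> * real_cond_exp M H (\<lambda>\<omega>. X \<omega> $ i) \<omega>"
      using integrable_of_square[OF sqint[of i]] by (intro real_cond_exp_mult) simp_all
    then show "AE \<omega> in M. real_cond_exp M H (\<lambda>\<omega>. (?I \<omega> *\<^sub>R X \<omega>) $ i) \<omega> = 0"
      using moments(3)[of "axis i 1"] unfolding ax by eventually_elim simp
    \<comment> \<open>Polarisation: the squared projection on \<open>?a\<close> minus the two
      coordinate squares is twice the product of the coordinates.\<close>
    let ?a = "axis i 1 + axis j 1 :: real ^ 'k"
    let ?f = "\<lambda>\<omega>. ?I \<omega> * (?a \<bullet> X \<omega>)\<^sup>2"
      and ?g = "\<lambda>\<omega>. ?I \<omega> * (X \<omega> $ i)\<^sup>2" and ?h = "\<lambda>\<omega>. ?I \<omega> * (X \<omega> $ j)\<^sup>2"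
    have f: "?f = (\<lambda>\<omega>. ?I \<omega> * (X \<omega> $ i * X \<omega> $ i) + ?I \<omega> * (X \<omega> $ j * X \<omega> $ j) + 2 * (?I \<omega> * (X \<omega> $ i * X \<omega> $ j)))"
      by (simp add: fun_eq_iff inner_add_left ax power2_eq_square algebra_simps)
    have int: "integrable M ?f" "integrable M ?g" "integrable M ?h"
      unfolding f using int2 by (simp_all add: power2_eq_square)
    have eq: "(?I \<omega> *\<^sub>R X \<omega>) $ i * (?I \<omega> *\<^sub>R X \<omega>) $ j = (?f \<omega> - ?g \<omega> - ?h \<omega>) / 2" for \<omega>
      by (simp add: inner_add_left ax power2_eq_square algebra_simps indicator_def)
    have "AE \<omega> in M. real_cond_exp M H (\<lambda>\<omega>. (?f \<omega> - ?g \<omega> - ?h \<omega>) / 2) \<omega> =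
        real_cond_exp M H (\<lambda>\<omega>. ?f \<omega> - ?g \<omega> - ?h \<omega>) \<omega> / 2"
      using int by (intro real_cond_exp_cdiv) simp
    moreover have "AE \<omega> in M. real_cond_exp M H (\<lambda>\<omega>. ?f \<omega> - ?g \<omega> - ?h \<omega>) \<omega> =
        real_cond_exp M H (\<lambda>\<omega>. ?f \<omega> - ?g \<omega>) \<omega> - real_cond_exp M H ?h \<omega>"
      using int by (intro real_cond_exp_diff) simp_all
    moreover have "AE \<omega> in M. real_cond_exp M H (\<lambda>\<omega>. ?f \<omega> - ?g \<omega>) \<omega> =
        real_cond_exp M H ?f \<omega> - real_cond_exp M H ?g \<omega>"
      using int by (intro real_cond_exp_diff) simp_all
    moreover have "AE \<omega> in M. real_cond_exp M H ?f \<omega> = ?I \<omega> * real_cond_exp M H (\<lambda>\<omega>. (?a \<bullet> X \<omega>)\<^sup>2) \<omega>"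
      using int by (intro real_cond_exp_mult) simp_all
    moreover have "AE \<omega> in M. real_cond_exp M H ?g \<omega> = ?I \<omega> * real_cond_exp M H (\<lambda>\<omega>. (X \<omega> $ i)\<^sup>2) \<omega>"
      using int by (intro real_cond_exp_mult) simp_all
    moreover have "AE \<omega> in M. real_cond_exp M H ?h \<omega> = ?I \<omega> * real_cond_exp M H (\<lambda>\<omega>. (X \<omega> $ j)\<^sup>2) \<omega>"
      using int by (intro real_cond_exp_mult) simp_all
    moreover note moments(2)[of ?a] moments(2)[of "axis i 1", unfolded ax] moments(2)[of "axis j 1", unfolded ax]
    moreover note normal
    ultimately show "AE \<omega> in M. real_cond_exp M H (\<lambda>\<omega>. (?I \<omega> *\<^sub>R X \<omega>) $ i * (?I \<omega> *\<^sub>R X \<omega>) $ j) \<omega> = (?I \<omega> *\<^sub>R C \<omega>) $ i $ j"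
      unfolding eq
    proof eventually_elim
      case (elim \<omega>)
      have "transpose (C \<omega>) $ i $ j = C \<omega> $ j $ i" by (simp add: transpose_def)
      then have "C \<omega> $ j $ i = C \<omega> $ i $ j" using elim by (simp add: is_mvnormal_def psd_def)
      then show ?case
        using elim by (simp add: inner_add_left ax Cax matrix_vector_right_distrib algebra_simps)
    qed
  qed
qed

text \<open>On \<open>E\<close> the vector is a centred part plus a bounded known part, and
  conditional expectations are local, so \<open>Z\<close> may fail to be integrable overall.\<close>

lemma cond_mean_cond_cov_eq:
  fixes Z :: "'a \<Rightarrow> real ^ 'k"
  assumes sub: "subalgebra M G" and E: "E \<in> sets G"
    and Z: "\<And>i. (\<lambda>\<omega>. Z \<omega> $ i) \<in> borel_measurable M" and mu: "\<And>i. (\<lambda>\<omega>. \<mu> \<omega> $ i) \<in> borel_measurable G"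
    and bd: "\<And>\<omega> i. \<omega> \<in> E \<Longrightarrow> \<bar>\<mu> \<omega> $ i\<bar> \<le> c"
    and cov: "centered_cov M G (\<lambda>\<omega>. indicator E \<omega> *\<^sub>R (Z \<omega> - \<mu> \<omega>)) S"
  shows "AE \<omega> in M. \<omega> \<in> E \<longrightarrow> cond_mean M G Z \<omega> = \<mu> \<omega> \<and> cond_cov M G Z \<omega> = S \<omega>"
proof -
  interpret sigma_finite_subalgebra M G by (rule subalgebra_sigma_finite[OF sub])
  have [measurable]: "E \<in> sets M" "E \<in> sets G" using sub E by (auto simp: subalgebra_def)
  note [measurable] = Z mu measurable_from_subalg[OF sub mu]
  let ?I = "indicator E :: 'a \<Rightarrow> real" and ?d = "\<lambda>\<omega>. indicator E \<omega> *\<^sub>R (Z \<omega> - \<mu> \<omega>)"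
  have mean: "AE \<omega> in M. \<omega> \<in> E \<longrightarrow> real_cond_exp M G (\<lambda>\<omega>. Z \<omega> $ i) \<omega> = \<mu> \<omega> $ i" for i
  proof -
    have intm: "integrable M (\<lambda>\<omega>. ?I \<omega> * \<mu> \<omega> $ i)"
    proof (rule integrable_const_bound[where B = "\<bar>c\<bar>"])
      have "norm (?I \<omega> * \<mu> \<omega> $ i) \<le> \<bar>c\<bar>" for \<omega>
        using bd[of \<omega> i] by (cases "\<omega> \<in> E") auto
      then show "AE \<omega> in M. norm (?I \<omega> * \<mu> \<omega> $ i) \<le> \<bar>c\<bar>" by simp
    qed measurable
    have "AE \<omega> in M. \<omega> \<in> E \<longrightarrow> real_cond_exp M G (\<lambda>\<omega>. Z \<omega> $ i) \<omega> = real_cond_exp M G (\<lambda>\<omega>. ?d \<omega> $ i + ?I \<omega> * \<mu> \<omega> $ i) \<omega>"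
      by (rule real_cond_exp_local[OF sub E]) (auto simp: indicator_def)
    moreover have "AE \<omega> in M. real_cond_exp M G (\<lambda>\<omega>. ?d \<omega> $ i + ?I \<omega> * \<mu> \<omega> $ i) \<omega> =
        real_cond_exp M G (\<lambda>\<omega>. ?d \<omega> $ i) \<omega> + real_cond_exp M G (\<lambda>\<omega>. ?I \<omega> * \<mu> \<omega> $ i) \<omega>"
      by (intro real_cond_exp_add centered_cov_integrable[OF cov] intm)
    moreover have "AE \<omega> in M. real_cond_exp M G (\<lambda>\<omega>. ?I \<omega> * \<mu> \<omega> $ i) \<omega> = ?I \<omega> * \<mu> \<omega> $ i"
      by (intro real_cond_exp_F_meas intm) measurable
    moreover note centered_covD(3)[OF cov, of i]
    ultimately show ?thesis by eventually_elim auto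
  qed
  have means: "AE \<omega> in M. \<omega> \<in> E \<longrightarrow> cond_mean M G Z \<omega> = \<mu> \<omega>"
  proof -
    have "AE \<omega> in M. \<forall>i. \<omega> \<in> E \<longrightarrow> real_cond_exp M G (\<lambda>\<omega>. Z \<omega> $ i) \<omega> = \<mu> \<omega> $ i"
      unfolding AE_all_countable by (intro allI mean)
    then show ?thesis by eventually_elim (simp add: cond_mean_def vec_eq_iff)
  qed
  have mm [measurable]: "(\<lambda>\<omega>. cond_mean M G Z \<omega> $ i) \<in> borel_measurable M" for i
    by (simp add: cond_mean_def)
  have "AE \<omega> in M. \<omega> \<in> E \<longrightarrow> real_cond_exp M G
      (\<lambda>\<omega>'. (Z \<omega>' $ i - cond_mean M G Z \<omega>' $ i) * (Z \<omega>' $ j - cond_mean M G Z \<omega>' $ j)) \<omega> = S \<omega> $ i $ j" for i j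
  proof -
    have "AE \<omega> in M. \<omega> \<in> E \<longrightarrow> real_cond_exp M G
      (\<lambda>\<omega>'. (Z \<omega>' $ i - cond_mean M G Z \<omega>' $ i) * (Z \<omega>' $ j - cond_mean M G Z \<omega>' $ j)) \<omega> =
      real_cond_exp M G (\<lambda>\<omega>. ?d \<omega> $ i * ?d \<omega> $ j) \<omega>"
    \<comment> \<open>\<open>cond_cov\<close> centres at \<open>cond_mean\<close>, which is
      identified with \<mu> only on \<open>E\<close> and up to a null set; locality asks for no
      more.\<close>
    proof (rule real_cond_exp_local[OF sub E])
      show "AE \<omega> in M. \<omega> \<in> E \<longrightarrow> (Z \<omega> $ i - cond_mean M G Z \<omega> $ i) * (Z \<omega> $ j - cond_mean M G Z \<omega> $ j) =
          ?d \<omega> $ i * ?d \<omega> $ j"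
        using means by eventually_elim simp
    qed (auto intro: centered_covD[OF cov])
    then show ?thesis using centered_covD(4)[OF cov, of i j] by eventually_elim simp
  qed
  then have "AE \<omega> in M. \<forall>i j. \<omega> \<in> E \<longrightarrow> real_cond_exp M G
      (\<lambda>\<omega>'. (Z \<omega>' $ i - cond_mean M G Z \<omega>' $ i) * (Z \<omega>' $ j - cond_mean M G Z \<omega>' $ j)) \<omega> = S \<omega> $ i $ j"
    unfolding AE_all_countable by blast
  then show ?thesis
    using means by eventually_elim (simp add: cond_cov_def vec_eq_iff)
qed

end

section \<open>Measurability along the closed loop\<close>

lemma borel_measurable_vec_nth:
  fixes f :: "'a \<Rightarrow> 'b :: euclidean_space ^ 'n"
  assumes "f \<in> borel_measurable M"
  shows "(\<lambda>\<omega>. f \<omega> $ i) \<in> borel_measurable M"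
  by (rule measurable_compose[OF assms borel_measurable_continuous_onI])
    (intro continuous_intros)

lemma borel_measurable_vecI:
  fixes f :: "'a \<Rightarrow> 'b :: euclidean_space ^ 'n"
  assumes "\<And>i. (\<lambda>\<omega>. f \<omega> $ i) \<in> borel_measurable M"
  shows "f \<in> borel_measurable M"
proof (subst borel_measurable_euclidean_space, rule ballI)
  fix b :: "'b ^ 'n" assume "b \<in> Basis"
  then obtain i c where "b = axis i c" by (auto simp: Basis_vec_def)
  then show "(\<lambda>\<omega>. f \<omega> \<bullet> b) \<in> borel_measurable M"
    using assms[of i] by (simp add: inner_axis)
qed

lemma borel_measurable_matrix_nth:
  fixes P :: "'a \<Rightarrow> real ^ 'k ^ 'l"
  shows "P \<in> borel_measurable M \<Longrightarrow> (\<lambda>\<omega>. P \<omega> $ i $ j) \<in> borel_measurable M"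
  by (intro borel_measurable_vec_nth)

lemma borel_measurable_matrixI:
  fixes P :: "'a \<Rightarrow> real ^ 'k ^ 'l"
  shows "(\<And>i j. (\<lambda>\<omega>. P \<omega> $ i $ j) \<in> borel_measurable M) \<Longrightarrow> P \<in> borel_measurable M"
  by (intro borel_measurable_vecI)

lemma borel_measurable_matrix_mult:
  assumes "P \<in> borel_measurable M" "Q \<in> borel_measurable M"
  shows "(\<lambda>\<omega>. P \<omega> ** Q \<omega> :: real ^ 'k ^ 'l) \<in> borel_measurable M"
  by (rule borel_measurable_matrixI)
    (simp only: matrix_matrix_mult_def vec_lambda_beta, intro borel_measurable_sum
      borel_measurable_times borel_measurable_matrix_nth[OF assms(1)] borel_measurable_matrix_nth[OF assms(2)])

lemma borel_measurable_matrix_vector_mult: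
  assumes "P \<in> borel_measurable M" "y \<in> borel_measurable M"
  shows "(\<lambda>\<omega>. P \<omega> *v y \<omega> :: real ^ 'l) \<in> borel_measurable M"
  by (rule borel_measurable_vecI)
    (simp only: matrix_vector_mult_def vec_lambda_beta, intro borel_measurable_sum
      borel_measurable_times borel_measurable_matrix_nth[OF assms(1)] borel_measurable_vec_nth[OF assms(2)])

lemma borel_measurable_transpose:
  assumes "P \<in> borel_measurable M"
  shows "(\<lambda>\<omega>. transpose (P \<omega> :: real ^ 'k ^ 'l)) \<in> borel_measurable M"
  by (rule borel_measurable_matrixI) (simp add: transpose_def borel_measurable_matrix_nth[OF assms])

lemma borel_measurable_det:
  fixes P :: "'a \<Rightarrow> real ^ 'k ^ 'k"
  assumes "\<And>i j. (\<lambda>\<omega>. P \<omega> $ i $ j) \<in> borel_measurable M"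
  shows "(\<lambda>\<omega>. det (P \<omega>)) \<in> borel_measurable M"
  unfolding det_def using assms
  by (intro borel_measurable_sum borel_measurable_times borel_measurable_prod) auto

text \<open>Quotients of determinants are rational in the entries, which makes the inverse
  measurable.\<close>

lemma matrix_inv_cramer:
  fixes P :: "real ^ 'k ^ 'k"
  assumes "det P \<noteq> 0"
  shows "matrix_inv P $ k $ j = det (\<chi> i l. if l = k then axis j 1 $ i else P $ i $ l) / det P"
proof -
  have "invertible P" using assms by (simp add: invertible_det_nz)
  then have "P ** matrix_inv P = mat 1"
    using someI_ex[of "\<lambda>Q. P ** Q = mat 1 \<and> Q ** P = mat 1"] by (simp add: matrix_inv_def invertible_def)
  then have "P *v (matrix_inv P *v axis j 1) = axis j 1"
    by (simp add: matrix_vector_mul_assoc)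
  then have "matrix_inv P *v axis j 1 = (\<chi> k. det (\<chi> i l. if l = k then axis j 1 $ i else P $ i $ l) / det P)"
    using cramer[OF assms] by blast
  moreover have "(matrix_inv P *v axis j 1) $ k = matrix_inv P $ k $ j"
    by (simp add: matrix_vector_mul_component inner_axis)
  ultimately show ?thesis by simp
qed

lemma borel_measurable_matrix_inv:
  fixes P :: "'a \<Rightarrow> real ^ 'k ^ 'k"
  assumes P: "P \<in> borel_measurable M"
  shows "(\<lambda>\<omega>. matrix_inv (P \<omega>)) \<in> borel_measurable M"
proof (rule borel_measurable_matrixI)
  fix k j
  txt \<open>On singular matrices \<^const>\<open>matrix_inv\<close> is the constant \<open>SOME Q. False\<close>.\<close>
  have "matrix_inv (P \<omega>) = (SOME Q. False)" if "det (P \<omega>) = 0" for \<omega>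
  proof -
    have "\<not> (P \<omega> ** Q = mat 1 \<and> Q ** P \<omega> = mat 1)" for Q
      using that invertible_det_nz[of "P \<omega>"] unfolding invertible_def by blast
    then have "(\<lambda>Q. P \<omega> ** Q = mat 1 \<and> Q ** P \<omega> = mat 1) = (\<lambda>Q. False)" by blast
    then show ?thesis by (simp only: matrix_inv_def)
  qed
  then have "(\<lambda>\<omega>. matrix_inv (P \<omega>) $ k $ j) = (\<lambda>\<omega>. if det (P \<omega>) = 0 then (SOME Q. False) $ k $ j else
      det (\<chi> i l. if l = k then axis j 1 $ i else P \<omega> $ i $ l) / det (P \<omega>))"
    by (auto simp: matrix_inv_cramer)
  moreover have [measurable]: "(\<lambda>\<omega>. det (P \<omega>)) \<in> borel_measurable M"
    by (intro borel_measurable_det borel_measurable_matrix_nth P)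
  moreover have [measurable]: "(\<lambda>\<omega>. det (\<chi> i l. if l = k then axis j 1 $ i else P \<omega> $ i $ l)) \<in> borel_measurable M"
  proof (rule borel_measurable_det)
    fix i l
    show "(\<lambda>\<omega>. (\<chi> i l. if l = k then axis j 1 $ i else P \<omega> $ i $ l) $ i $ l) \<in> borel_measurable M"
      using borel_measurable_matrix_nth[OF P] by (cases "l = k") simp_all
  qed
  ultimately show "(\<lambda>\<omega>. matrix_inv (P \<omega>) $ k $ j) \<in> borel_measurable M" by simp
qed

lemma borel_measurable_gain_input_cov:
  fixes S :: "'a \<Rightarrow> real ^ ('n::finite + 'm::finite) ^ ('n + 'm)"
  assumes S: "S \<in> borel_measurable M"
  shows borel_measurable_gain: "(\<lambda>\<omega>. gain (S \<omega>)) \<in> borel_measurable M"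
    and borel_measurable_input_cov: "(\<lambda>\<omega>. input_cov (S \<omega>)) \<in> borel_measurable M"
proof -
  have blocks: "(\<lambda>\<omega>. block_xx (S \<omega>)) \<in> borel_measurable M" "(\<lambda>\<omega>. block_ux (S \<omega>)) \<in> borel_measurable M"
    "(\<lambda>\<omega>. block_uu (S \<omega>)) \<in> borel_measurable M"
    by (rule borel_measurable_matrixI,
        simp add: block_xx_def block_ux_def block_uu_def borel_measurable_matrix_nth[OF S])+
  show gain: "(\<lambda>\<omega>. gain (S \<omega>)) \<in> borel_measurable M"
    unfolding gain_def by (intro borel_measurable_matrix_mult borel_measurable_matrix_inv blocks)
  show "(\<lambda>\<omega>. input_cov (S \<omega>)) \<in> borel_measurable M"
    unfolding input_cov_def
    by (intro borel_measurable_diff borel_measurable_matrix_mult borel_measurable_transpose gain blocks)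
qed

lemma borel_measurable_transition:
  assumes "\<And>i. i < j \<Longrightarrow> (\<lambda>\<omega>. L i \<omega>) \<in> borel_measurable M"
  shows "(\<lambda>\<omega>. transition (\<lambda>i. L i \<omega>) j) \<in> borel_measurable M"
  using assms by (induction j) (auto intro!: borel_measurable_matrix_mult)

lemma borel_measurable_feedback:
  fixes K :: "'a \<Rightarrow> real ^ 'n ^ 'm"
  assumes "K \<in> borel_measurable M"
  shows "(\<lambda>\<omega>. feedback (K \<omega>)) \<in> borel_measurable M"
proof (rule borel_measurable_matrixI)
  fix i j
  show "(\<lambda>\<omega>. feedback (K \<omega>) $ i $ j) \<in> borel_measurable M"
    using assms by (cases i) (simp_all add: feedback_def transpose_def hcat_def borel_measurable_matrix_nth)
qed

lemma abs_matrix_nth_le_norm: "\<bar>P $ i $ j\<bar> \<le> norm (P :: real ^ 'k ^ 'l)"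
  using component_le_norm_cart[of "P $ i" j] Finite_Cartesian_Product.norm_nth_le[of P i] by simp

lemma borel_measurable_generated_sets:
  assumes "space N = space M" "generated_sets M X \<subseteq> sets N"
  shows "X \<in> borel_measurable N"
proof (rule measurableI)
  fix D :: "'b set" assume "D \<in> sets borel"
  then have "X -` D \<inter> space M \<in> generated_sets M X"
    by (auto simp: sets_vimage_algebra2)
  then show "X -` D \<inter> space N \<in> sets N" using assms by auto
qed simp

lemma generated_sets_subset:
  assumes "X \<in> borel_measurable M"
  shows "generated_sets M X \<subseteq> sets M"
  using assms by (auto simp: sets_vimage_algebra2)

section \<open>The filtration of the closed loop\<close>

context closed_loop
begin

definition past :: "nat \<Rightarrow> 'a measure" where
  "past t = history M (x 1) v w \<Sigma> t"

definition generators :: "nat \<Rightarrow> 'a set set" where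
  "generators t = generated_sets M (x 1) \<union> (\<Union>s\<in>{1..t}. generated_sets M (\<Sigma> s)) \<union>
      (\<Union>s\<in>{1..<t}. generated_sets M (v s) \<union> generated_sets M (w s))"

lemma w_measurable: "s \<in> {1..T} \<Longrightarrow> w s \<in> borel_measurable M"
  using w_indep by (auto simp: indep_vars_def)

lemma generators_subset: "generators t \<subseteq> Pow (space M)"
  by (auto simp: generators_def sets_vimage_algebra2)

lemma space_past [simp]: "space (past t) = space M"
  unfolding past_def history_def by (rule space_measure_of) (rule generators_subset[unfolded generators_def])

lemma sets_past: "sets (past t) = sigma_sets (space M) (generators t)"
  unfolding past_def history_def generators_def
  by (rule sets_measure_of) (rule generators_subset[unfolded generators_def])

lemma generators_in_past: "generators t \<subseteq> sets (past t)"
  unfolding sets_past by auto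

lemma subalgebra_past: "t \<le> T \<Longrightarrow> subalgebra M (past t)"
proof -
  assume t: "t \<le> T"
  have "generators t \<subseteq> sets M"
    unfolding generators_def using t
    by (intro Un_least UN_least generated_sets_subset x1_measurable target_measurable v_measurable w_measurable) auto
  then show ?thesis
    unfolding subalgebra_def sets_past by (auto dest: sets.sigma_sets_subset)
qed

lemma subalgebra_past_mono: "s \<le> t \<Longrightarrow> subalgebra (past t) (past s)"
proof -
  assume st: "s \<le> t"
  have "generators s \<subseteq> generators t" unfolding generators_def using st by (intro Un_mono UN_mono) auto
  then show ?thesis
    unfolding subalgebra_def sets_past by (auto intro: sigma_sets_mono'[THEN subsetD])
qed

lemma past_measurable:
  "x 1 \<in> borel_measurable (past t)"
  "s \<in> {1..t} \<Longrightarrow> \<Sigma> s \<in> borel_measurable (past t)"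
  "s \<in> {1..<t} \<Longrightarrow> v s \<in> borel_measurable (past t)"
  "s \<in> {1..<t} \<Longrightarrow> w s \<in> borel_measurable (past t)"
proof -
  show "x 1 \<in> borel_measurable (past t)"
    by (rule borel_measurable_generated_sets, rule space_past)
      (rule order_trans[OF _ generators_in_past], unfold generators_def, blast)
  show "\<Sigma> s \<in> borel_measurable (past t)" if "s \<in> {1..t}"
    by (rule borel_measurable_generated_sets, rule space_past)
      (rule order_trans[OF _ generators_in_past], unfold generators_def, use that in blast)
  show "v s \<in> borel_measurable (past t)" "w s \<in> borel_measurable (past t)" if "s \<in> {1..<t}"
    by (rule borel_measurable_generated_sets, rule space_past,
      rule order_trans[OF _ generators_in_past], unfold generators_def, use that in blast)+
qed

lemma next_state:
  assumes "s \<in> {1..T}" "\<omega> \<in> space M"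
  shows "x (Suc s) \<omega> = (A + B ** gain (\<Sigma> s \<omega>)) *v x s \<omega> + B *v v s \<omega> + w s \<omega>"
  using state_eq[OF assms] input_eq[OF assms]
  by (simp add: matrix_vector_right_distrib matrix_vector_mult_add_rdistrib matrix_vector_mul_assoc)

lemma state_measurable: "s \<in> {1..T} \<Longrightarrow> x s \<in> borel_measurable (past s)"
proof (induction s)
  case (Suc s)
  show ?case
  \<comment> \<open>The recursion starts at time 1, and the initial state is itself a
    generator.\<close>
  proof (cases "s = 0")
    case True
    then show ?thesis using past_measurable(1)[of 1] by simp
  next
    case False
    then have s: "s \<in> {1..T}" using Suc.prems by simp
    have "x s \<in> borel_measurable (past (Suc s))"
      using Suc.IH[OF s] subalgebra_past_mono[of s "Suc s"] by (simp add: measurable_from_subalg)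
    moreover have "\<Sigma> s \<in> borel_measurable (past (Suc s))" "v s \<in> borel_measurable (past (Suc s))"
      "w s \<in> borel_measurable (past (Suc s))"
      using s by (auto intro!: past_measurable)
    ultimately have "(\<lambda>\<omega>. (A + B ** gain (\<Sigma> s \<omega>)) *v x s \<omega> + B *v v s \<omega> + w s \<omega>) \<in> borel_measurable (past (Suc s))"
      by (intro borel_measurable_add borel_measurable_matrix_vector_mult borel_measurable_matrix_mult
          borel_measurable_gain borel_measurable_const)
    then show ?thesis
      using next_state[OF s] by (subst measurable_cong) simp_all
  qed
qed simp

text \<open>The algebra between the two draws of a step: \<open>v s\<close> is known,
  \<open>w s\<close> is still fresh. The noises can thus be added one after the other, each centred
  given what precedes it.\<close>

definition pre_noise :: "nat \<Rightarrow> 'a measure" where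
  "pre_noise s = sigma (space M) (sets (past s) \<union> generated_sets M (v s))"

lemma pre_noise:
  assumes "s \<in> {1..T}"
  shows "subalgebra M (pre_noise s)" "subalgebra (pre_noise s) (past s)" "v s \<in> borel_measurable (pre_noise s)"
    "indep_set (sets (pre_noise s)) (generated_sets M (w s))"
proof -
  have sub: "sets (past s) \<union> generated_sets M (v s) \<subseteq> sets M"
  proof (rule Un_least)
    show "sets (past s) \<subseteq> sets M"
      using subalgebra_past[of s] assms by (simp add: subalgebra_def)
  qed (rule generated_sets_subset[OF v_measurable[OF assms]])
  then have pow: "sets (past s) \<union> generated_sets M (v s) \<subseteq> Pow (space M)"
    using sets.space_closed by blast
  have sp: "space (pre_noise s) = space M"
    unfolding pre_noise_def by (rule space_measure_of[OF pow])
  have st: "sets (pre_noise s) = sigma_sets (space M) (sets (past s) \<union> generated_sets M (v s))"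
    unfolding pre_noise_def by (rule sets_measure_of[OF pow])
  show "subalgebra M (pre_noise s)"
    using sets.sigma_sets_subset[OF sub] by (simp add: subalgebra_def sp st)
  show "subalgebra (pre_noise s) (past s)"
    by (auto simp: subalgebra_def sp st)
  show "v s \<in> borel_measurable (pre_noise s)"
    by (rule borel_measurable_generated_sets) (auto simp: sp st)
  show "indep_set (sets (pre_noise s)) (generated_sets M (w s))"
    using w_fresh[OF assms] by (simp only: st past_def)
qed

end

section \<open>Conditional moments of the closed loop\<close>

lemma centered_cov_cong:
  assumes "centered_cov M G e S" "\<And>\<omega>. \<omega> \<in> space M \<Longrightarrow> e \<omega> = e' \<omega>" "subalgebra M G" "prob_space M"
  shows "centered_cov M G e' S"
proof -
  interpret prob_space M by fact
  interpret sigma_finite_subalgebra M G by (rule subalgebra_sigma_finite) fact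
  have m: "(\<lambda>\<omega>. e' \<omega> $ i) \<in> borel_measurable M" for i
    using centered_covD(1)[OF assms(1), of i] by (subst measurable_cong[of M _ "\<lambda>\<omega>. e \<omega> $ i"]) (simp_all add: assms(2))
  note [measurable] = m centered_covD(1)[OF assms(1)]
  show ?thesis
  proof (rule centered_covI[OF m])
    show "integrable M (\<lambda>\<omega>. (e' \<omega> $ i)\<^sup>2)" for i
      using centered_covD(2)[OF assms(1), of i]
      by (subst Bochner_Integration.integrable_cong[of M M _ "\<lambda>\<omega>. (e \<omega> $ i)\<^sup>2"]) (simp_all add: assms(2))
    show "AE \<omega> in M. real_cond_exp M G (\<lambda>\<omega>. e' \<omega> $ i) \<omega> = 0" for i
    proof -
      have "AE \<omega> in M. real_cond_exp M G (\<lambda>\<omega>. e \<omega> $ i) \<omega> = real_cond_exp M G (\<lambda>\<omega>. e' \<omega> $ i) \<omega>"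
        by (rule real_cond_exp_cong) (auto simp: assms(2))
      then show ?thesis using centered_covD(3)[OF assms(1), of i] by eventually_elim simp
    qed
    show "AE \<omega> in M. real_cond_exp M G (\<lambda>\<omega>. e' \<omega> $ i * e' \<omega> $ j) \<omega> = S \<omega> $ i $ j" for i j
    proof -
      have "AE \<omega> in M. real_cond_exp M G (\<lambda>\<omega>. e \<omega> $ i * e \<omega> $ j) \<omega> = real_cond_exp M G (\<lambda>\<omega>. e' \<omega> $ i * e' \<omega> $ j) \<omega>"
        by (rule real_cond_exp_cong) (auto simp: assms(2))
      then show ?thesis using centered_covD(4)[OF assms(1), of i j] by eventually_elim simp
    qed
  qed
qed

text \<open>The window starts at \<open>r\<close>. Its targets are known there, so gains, input
  covariances and transition matrices act as constants given \<open>past r\<close>.\<close>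

locale known_targets = closed_loop M A B W \<sigma> T x u v w \<Sigma>
  for M :: "'a measure"
    and A :: "real ^ 'n ^ 'n" and B :: "real ^ 'm ^ 'n" and W :: "real ^ 'n ^ 'n"
    and \<sigma> :: real and T :: nat
    and x :: "nat \<Rightarrow> 'a \<Rightarrow> real ^ 'n" and u :: "nat \<Rightarrow> 'a \<Rightarrow> real ^ 'm"
    and v :: "nat \<Rightarrow> 'a \<Rightarrow> real ^ 'm" and w :: "nat \<Rightarrow> 'a \<Rightarrow> real ^ 'n"
    and \<Sigma> :: "nat \<Rightarrow> 'a \<Rightarrow> real ^ ('n::finite + 'm::finite) ^ ('n::finite + 'm::finite)" +
  fixes r \<rho> :: nat
  assumes start: "1 \<le> r" and horizon: "r + \<rho> \<le> T"
    and known: "j \<le> \<rho> \<Longrightarrow> \<Sigma> (r + j) \<in> borel_measurable (past r)"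
begin

abbreviation "K j \<omega> \<equiv> gain (\<Sigma> (r + j) \<omega>)"
abbreviation "U j \<omega> \<equiv> input_cov (\<Sigma> (r + j) \<omega>)"
abbreviation "L j \<omega> \<equiv> A + B ** K j \<omega>"
abbreviation "\<Phi> j \<omega> \<equiv> transition (\<lambda>i. L i \<omega>) j"
abbreviation "\<mu> \<omega> \<equiv> feedback (K \<rho> \<omega>) *v (\<Phi> \<rho> \<omega> *v x r \<omega>)"
abbreviation "Z \<omega> \<equiv> stack (x (r + \<rho>) \<omega>) (u (r + \<rho>) \<omega>)"

lemma times: "j \<le> \<rho> \<Longrightarrow> r + j \<in> {1..T}"
  using start horizon by simp

lemma sub: "subalgebra M (past r)"
  using horizon by (intro subalgebra_past) simp

lemma known_measurable:
  assumes "j \<le> \<rho>"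
  shows "K j \<in> borel_measurable (past r)" "U j \<in> borel_measurable (past r)" "L j \<in> borel_measurable (past r)"
    "\<Phi> j \<in> borel_measurable (past r)"
proof -
  have K: "K j \<in> borel_measurable (past r)" if "j \<le> \<rho>" for j
    using known[OF that] by (rule borel_measurable_gain)
  show "U j \<in> borel_measurable (past r)"
    using known[OF assms] by (rule borel_measurable_input_cov)
  have L: "L j \<in> borel_measurable (past r)" if "j \<le> \<rho>" for j
    by (intro borel_measurable_add borel_measurable_matrix_mult borel_measurable_const K that)
  show "K j \<in> borel_measurable (past r)" "L j \<in> borel_measurable (past r)"
    using assms by (rule K, rule L)
  show "\<Phi> j \<in> borel_measurable (past r)"
    using assms by (intro borel_measurable_transition L) simp
qed

lemma initial_measurable: "x r \<in> borel_measurable (past r)"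
  using times[of 0] by (intro state_measurable) simp

lemma mean_measurable: "\<mu> \<in> borel_measurable (past r)"
  by (intro borel_measurable_matrix_vector_mult borel_measurable_feedback known_measurable initial_measurable order_refl)

lemma later_state_measurable: "j \<le> \<rho> \<Longrightarrow> x (r + j) \<in> borel_measurable (past (r + j))"
  by (intro state_measurable times)

text \<open>A truncation event on which all coefficients are bounded. It is known at time
  \<open>r\<close>, so its indicator also acts as a constant given \<open>past r\<close>.\<close>

context
  fixes E :: "'a set" and c :: real
  assumes E: "E \<in> sets (past r)"
    and bounded: "\<And>\<omega> j. \<omega> \<in> E \<Longrightarrow> j \<le> \<rho> \<Longrightarrow> norm (L j \<omega>) \<le> c"
      "\<And>\<omega> j. \<omega> \<in> E \<Longrightarrow> j \<le> \<rho> \<Longrightarrow> norm (U j \<omega>) \<le> c"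
      "\<And>\<omega>. \<omega> \<in> E \<Longrightarrow> norm (feedback (K \<rho> \<omega>)) \<le> c"
      "\<And>\<omega>. \<omega> \<in> E \<Longrightarrow> norm (\<mu> \<omega>) \<le> c"
begin

abbreviation "I \<equiv> indicator E :: 'a \<Rightarrow> real"

text \<open>Off \<open>E\<close> the entry is 0. The absolute value of \<open>c\<close> covers an
  empty \<open>E\<close>, which fixes no sign of \<open>c\<close>.\<close>

lemma indicator_matrix_bounded:
  assumes "\<And>\<omega>. \<omega> \<in> E \<Longrightarrow> norm (P \<omega> :: real ^ 'k ^ 'l) \<le> c"
  shows "\<bar>(I \<omega> *\<^sub>R P \<omega>) $ i $ j\<bar> \<le> \<bar>c\<bar>"
  using assms[of \<omega>] abs_matrix_nth_le_norm[of "P \<omega>" i j] by (auto simp: indicator_def)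

lemma E_past: "r \<le> s \<Longrightarrow> E \<in> sets (past s)"
  using E subalgebra_past_mono[of r s] by (auto simp: subalgebra_def)

lemma input_noise_cov:
  fixes P :: "real ^ 'm ^ 'l"
  assumes j: "j \<le> \<rho>"
  shows "centered_cov M (past (r + j)) (\<lambda>\<omega>. P *v (I \<omega> *\<^sub>R v (r + j) \<omega>)) (\<lambda>\<omega>. P ** (I \<omega> *\<^sub>R U j \<omega>) ** transpose P)"
proof -
  have subj: "subalgebra M (past (r + j))" using times[OF j] by (intro subalgebra_past) simp
  obtain \<kappa> where \<kappa>: "cond_law M (past (r + j)) (v (r + j)) \<kappa>" "AE \<omega> in M. is_mvnormal (\<kappa> \<omega>) 0 (U j \<omega>)"
    using v_normal[OF times[OF j]] unfolding past_def by blast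
  have "centered_cov M (past (r + j)) (\<lambda>\<omega>. I \<omega> *\<^sub>R v (r + j) \<omega>) (\<lambda>\<omega>. I \<omega> *\<^sub>R U j \<omega>)"
  proof (rule centered_cov_mvnormal[OF subj v_measurable[OF times[OF j]] \<kappa> E_past])
    show "U j \<omega> $ i $ i \<le> c" if "\<omega> \<in> E" for \<omega> i
      using bounded(2)[OF that j] abs_matrix_nth_le_norm[of "U j \<omega>" i i] by linarith
  qed simp
  then show ?thesis
    by (rule centered_cov_linear[OF subj, where c = "norm P"]) (simp_all add: abs_matrix_nth_le_norm)
qed

lemma process_noise_cov:
  assumes s: "s \<in> {1..T}" "r \<le> s"
  shows "centered_cov M (pre_noise s) (\<lambda>\<omega>. I \<omega> *\<^sub>R w s \<omega>) (\<lambda>\<omega>. I \<omega> *\<^sub>R W)"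
proof (rule centered_cov_mvnormal[OF pre_noise(1)[OF s(1)] w_measurable[OF s(1)]
    cond_law_indep[OF pre_noise(1)[OF s(1)] w_measurable[OF s(1)] pre_noise(4)[OF s(1)]]])
  show "AE \<omega> in M. is_mvnormal (distr M borel (w s)) 0 W" using w_normal[OF s(1)] by simp
  show "E \<in> sets (pre_noise s)" using E_past[OF s(2)] pre_noise(2)[OF s(1)] by (auto simp: subalgebra_def)
  show "W $ i $ i \<le> norm W" for i
    using abs_matrix_nth_le_norm[of W i i] by linarith
qed

abbreviation "e j \<omega> \<equiv> I \<omega> *\<^sub>R (x (r + j) \<omega> - \<Phi> j \<omega> *v x r \<omega>)"
abbreviation "N j \<omega> \<equiv> B ** (I \<omega> *\<^sub>R U j \<omega>) ** transpose B + I \<omega> *\<^sub>R W"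

lemma indicator_measurable: "E \<in> sets G \<Longrightarrow> I \<in> borel_measurable G"
  by simp

lemma error_measurable:
  assumes j: "j \<le> \<rho>"
  shows "e j \<in> borel_measurable (past (r + j))"
proof -
  show ?thesis
    by (intro borel_measurable_scaleR borel_measurable_diff borel_measurable_matrix_vector_mult
        indicator_measurable E_past later_state_measurable j measurable_from_subalg[OF subalgebra_past_mono known_measurable(4)[OF j]]
        measurable_from_subalg[OF subalgebra_past_mono initial_measurable]) simp_all
qed

lemma I_matrix_measurable:
  assumes "P \<in> borel_measurable (past r)"
  shows "(\<lambda>\<omega>. (I \<omega> *\<^sub>R (P \<omega> :: real ^ 'k ^ 'l)) $ i $ j) \<in> borel_measurable (past r)"
  by (intro borel_measurable_matrix_nth borel_measurable_scaleR indicator_measurable E assms)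

text \<open>Truncation is idempotent, so the truncated error obeys the recursion with truncated
  coefficients. A step is a known linear map, then input noise, then process noise, each noise
  centred given an algebra in which the earlier terms are measurable.\<close>

lemma state_error_cov:
  "j \<le> \<rho> \<Longrightarrow> centered_cov M (past r) (e j) (\<lambda>\<omega>. state_cov (\<lambda>i. I \<omega> *\<^sub>R L i \<omega>) (\<lambda>i. N i \<omega>) j)"
proof (induction j)
  case 0
  then show ?case using centered_cov_zero[OF sub] by simp
next
  case (Suc j)
  then have j: "j \<le> \<rho>" by simp
  let ?s = "r + j"
  note s = times[OF j]
  let ?S = "\<lambda>\<omega>. state_cov (\<lambda>i. I \<omega> *\<^sub>R L i \<omega>) (\<lambda>i. N i \<omega>) j"
  have subs: "subalgebra M (past ?s)" "subalgebra (past ?s) (past r)"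
    using s by (simp_all add: subalgebra_past subalgebra_past_mono)
  have subs': "subalgebra (pre_noise ?s) (past r)"
    using pre_noise(2)[OF s] subs(2) by (auto simp: subalgebra_def)
  let ?a = "\<lambda>\<omega>. (I \<omega> *\<^sub>R L j \<omega>) *v e j \<omega>"
  let ?b = "\<lambda>\<omega>. B *v (I \<omega> *\<^sub>R v ?s \<omega>)"
  have meas_a: "?a \<in> borel_measurable (past ?s)"
    by (intro borel_measurable_matrix_vector_mult borel_measurable_scaleR error_measurable[OF j] indicator_measurable E_past
      measurable_from_subalg[OF subs(2) known_measurable(3)[OF j]]) simp
  have "centered_cov M (past r) ?a (\<lambda>\<omega>. (I \<omega> *\<^sub>R L j \<omega>) ** ?S \<omega> ** transpose (I \<omega> *\<^sub>R L j \<omega>))"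
    by (rule centered_cov_linear[OF sub Suc.IH[OF j] I_matrix_measurable indicator_matrix_bounded])
      (auto intro: known_measurable(3) j bounded(1))
  then have "centered_cov M (past r) (\<lambda>\<omega>. ?a \<omega> + ?b \<omega>)
      (\<lambda>\<omega>. (I \<omega> *\<^sub>R L j \<omega>) ** ?S \<omega> ** transpose (I \<omega> *\<^sub>R L j \<omega>) + B ** (I \<omega> *\<^sub>R U j \<omega>) ** transpose B)"
  proof (rule centered_cov_add[OF subs _ _ input_noise_cov[OF j]])
    show "(\<lambda>\<omega>. ?a \<omega> $ i) \<in> borel_measurable (past ?s)" for i
      using meas_a by (rule borel_measurable_vec_nth)
    show "(\<lambda>\<omega>. (B ** (I \<omega> *\<^sub>R U j \<omega>) ** transpose B) $ i $ k) \<in> borel_measurable (past r)" for i k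
      by (intro borel_measurable_matrix_nth borel_measurable_matrix_mult borel_measurable_scaleR
          indicator_measurable E known_measurable(2) j borel_measurable_const)
  qed
  then have "centered_cov M (past r) (\<lambda>\<omega>. (?a \<omega> + ?b \<omega>) + I \<omega> *\<^sub>R w ?s \<omega>)
      (\<lambda>\<omega>. ((I \<omega> *\<^sub>R L j \<omega>) ** ?S \<omega> ** transpose (I \<omega> *\<^sub>R L j \<omega>) + B ** (I \<omega> *\<^sub>R U j \<omega>) ** transpose B) + I \<omega> *\<^sub>R W)"
  \<comment> \<open>The input noise is now part of the accumulated error, so the finer algebra
    becomes \<open>pre_noise ?s\<close>, where \<open>v ?s\<close> is measurable and
    \<open>w ?s\<close> still independent.\<close>
  proof (rule centered_cov_add[OF pre_noise(1)[OF s] subs' _ _ process_noise_cov[OF s]])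
    have "?b \<in> borel_measurable (pre_noise ?s)"
      by (intro borel_measurable_matrix_vector_mult borel_measurable_scaleR indicator_measurable
          pre_noise(3)[OF s] borel_measurable_const) (use E subs' in \<open>auto simp: subalgebra_def\<close>)
    then show "(\<lambda>\<omega>. (?a \<omega> + ?b \<omega>) $ i) \<in> borel_measurable (pre_noise ?s)" for i
      by (intro borel_measurable_vec_nth borel_measurable_add measurable_from_subalg[OF pre_noise(2)[OF s] meas_a])
    show "(\<lambda>\<omega>. (I \<omega> *\<^sub>R W) $ i $ k) \<in> borel_measurable (past r)" for i k
      by (intro borel_measurable_matrix_nth borel_measurable_scaleR indicator_measurable E borel_measurable_const)
  qed simp
  then have "centered_cov M (past r) (e (Suc j))
      (\<lambda>\<omega>. ((I \<omega> *\<^sub>R L j \<omega>) ** ?S \<omega> ** transpose (I \<omega> *\<^sub>R L j \<omega>) + B ** (I \<omega> *\<^sub>R U j \<omega>) ** transpose B) + I \<omega> *\<^sub>R W)"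
  proof (rule centered_cov_cong[OF _ _ sub prob_space_axioms])
    fix \<omega> assume \<omega>: "\<omega> \<in> space M"
    \<comment> \<open>On \<open>E\<close> this is the recursion for the deviation from the noiseless
      path; off \<open>E\<close> both sides are 0.\<close>
    show "(?a \<omega> + ?b \<omega>) + I \<omega> *\<^sub>R w ?s \<omega> = e (Suc j) \<omega>"
      using next_state[OF s \<omega>]
      by (cases "\<omega> \<in> E") (simp_all add: matrix_vector_mult_diff_distrib matrix_vector_mul_assoc)
  qed
  then show ?case by (simp add: add.assoc)
qed

text \<open>The final state-input vector contains \<open>v\<close> of its own time but not
  \<open>w\<close>, so a single addition over \<open>past (r + \<rho>)\<close> completes the state
  error.\<close>

lemma observation_error_cov:
  "centered_cov M (past r) (\<lambda>\<omega>. I \<omega> *\<^sub>R (Z \<omega> - \<mu> \<omega>))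
    (\<lambda>\<omega>. (I \<omega> *\<^sub>R feedback (K \<rho> \<omega>)) ** state_cov (\<lambda>i. I \<omega> *\<^sub>R L i \<omega>) (\<lambda>i. N i \<omega>) \<rho> **
        transpose (I \<omega> *\<^sub>R feedback (K \<rho> \<omega>))
      + input_inclusion ** (I \<omega> *\<^sub>R U \<rho> \<omega>) ** transpose input_inclusion)"
    (is "centered_cov M _ _ ?C")
proof -
  let ?s = "r + \<rho>"
  note s = times[OF order_refl]
  have subs: "subalgebra M (past ?s)" "subalgebra (past ?s) (past r)"
    using s by (simp_all add: subalgebra_past subalgebra_past_mono)
  let ?S = "\<lambda>\<omega>. state_cov (\<lambda>i. I \<omega> *\<^sub>R L i \<omega>) (\<lambda>i. N i \<omega>) \<rho>"
  let ?a = "\<lambda>\<omega>. (I \<omega> *\<^sub>R feedback (K \<rho> \<omega>)) *v e \<rho> \<omega>"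
  let ?b = "\<lambda>\<omega>. input_inclusion *v (I \<omega> *\<^sub>R v ?s \<omega>)"
  have KG: "(\<lambda>\<omega>. feedback (K \<rho> \<omega>)) \<in> borel_measurable (past r)"
    by (intro borel_measurable_feedback known_measurable order_refl)
  have "centered_cov M (past r) ?a (\<lambda>\<omega>. (I \<omega> *\<^sub>R feedback (K \<rho> \<omega>)) ** ?S \<omega> ** transpose (I \<omega> *\<^sub>R feedback (K \<rho> \<omega>)))"
    by (rule centered_cov_linear[OF sub state_error_cov[OF order_refl], where c = "\<bar>c\<bar>"],
      rule I_matrix_measurable[OF KG], rule indicator_matrix_bounded, rule bounded(3))
  then have "centered_cov M (past r) (\<lambda>\<omega>. ?a \<omega> + ?b \<omega>) ?C"
  proof (rule centered_cov_add[OF subs _ _ input_noise_cov[OF order_refl]])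
    have "?a \<in> borel_measurable (past ?s)"
      by (intro borel_measurable_matrix_vector_mult borel_measurable_scaleR error_measurable indicator_measurable E_past
        measurable_from_subalg[OF subs(2) KG]) simp_all
    then show "(\<lambda>\<omega>. ?a \<omega> $ i) \<in> borel_measurable (past ?s)" for i by (rule borel_measurable_vec_nth)
    show "(\<lambda>\<omega>. (input_inclusion ** (I \<omega> *\<^sub>R U \<rho> \<omega>) ** transpose input_inclusion) $ i $ k) \<in> borel_measurable (past r)" for i k
      by (intro borel_measurable_matrix_nth borel_measurable_matrix_mult borel_measurable_scaleR
          indicator_measurable E known_measurable(2) order_refl borel_measurable_const)
  qed
  then show ?thesis
  proof (rule centered_cov_cong[OF _ _ sub prob_space_axioms])
    fix \<omega> assume \<omega>: "\<omega> \<in> space M"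
    have "Z \<omega> = feedback (K \<rho> \<omega>) *v x ?s \<omega> + input_inclusion *v v ?s \<omega>"
      using input_eq[OF s \<omega>] by (auto simp: stack_def vec_eq_iff split: sum.split)
    then show "?a \<omega> + ?b \<omega> = I \<omega> *\<^sub>R (Z \<omega> - \<mu> \<omega>)"
      by (cases "\<omega> \<in> E") (simp_all add: matrix_vector_mult_diff_distrib del: feedback_mult input_inclusion_mult)
  qed
qed

text \<open>On \<open>E\<close> every indicator is 1, and the truncated formulas become the true
  ones.\<close>

lemma conditional_moments_on:
  "AE \<omega> in M. \<omega> \<in> E \<longrightarrow> cond_mean M (past r) Z \<omega> = \<mu> \<omega> \<and>
    cond_cov M (past r) Z \<omega> =
      feedback (K \<rho> \<omega>) ** state_cov (\<lambda>i. L i \<omega>) (\<lambda>i. B ** U i \<omega> ** transpose B + W) \<rho> ** transpose (feedback (K \<rho> \<omega>))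
      + input_inclusion ** U \<rho> \<omega> ** transpose input_inclusion"
proof -
  have Zm: "(\<lambda>\<omega>. Z \<omega> $ i) \<in> borel_measurable M" for i
  proof -
    note s = times[OF order_refl]
    have sub': "subalgebra M (past (r + \<rho>))" using s by (intro subalgebra_past) simp
    have x: "x (r + \<rho>) \<in> borel_measurable M"
      by (rule measurable_from_subalg[OF sub' later_state_measurable]) simp
    \<comment> \<open>Measurability of the input is derived from the feedback law.\<close>
    have "(\<lambda>\<omega>. K \<rho> \<omega> *v x (r + \<rho>) \<omega> + v (r + \<rho>) \<omega>) \<in> borel_measurable M"
      by (intro borel_measurable_add borel_measurable_matrix_vector_mult x v_measurable s
          measurable_from_subalg[OF sub known_measurable(1)[OF order_refl]])
    then have u: "u (r + \<rho>) \<in> borel_measurable M"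
      using input_eq[OF s] by (subst measurable_cong) simp_all
    show ?thesis
      using borel_measurable_vec_nth[OF x] borel_measurable_vec_nth[OF u] by (cases i) (simp_all add: stack_def)
  qed
  have bd: "\<bar>\<mu> \<omega> $ i\<bar> \<le> c" if "\<omega> \<in> E" for \<omega> i
    using bounded(4)[OF that] component_le_norm_cart[of "\<mu> \<omega>" i] by linarith
  show ?thesis
    by (rule eventually_mono[OF cond_mean_cond_cov_eq[OF sub E Zm
            borel_measurable_vec_nth[OF mean_measurable] _ observation_error_cov]], erule bd, simp)
qed

end

lemma conditional_moments:
  "AE \<omega> in M. cond_mean M (past r) Z \<omega> = \<mu> \<omega> \<and>
    cond_cov M (past r) Z \<omega> =
      feedback (K \<rho> \<omega>) ** state_cov (\<lambda>i. L i \<omega>) (\<lambda>i. B ** U i \<omega> ** transpose B + W) \<rho> ** transpose (feedback (K \<rho> \<omega>))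
      + input_inclusion ** U \<rho> \<omega> ** transpose input_inclusion" (is "AE \<omega> in M. ?Q \<omega>")
proof -
  txt \<open>All coefficients are bounded on each event \<open>b \<le> k\<close>, and these events exhaust the space.\<close>
  define b where "b \<omega> = (\<Sum>j\<le>\<rho>. norm (L j \<omega>) + norm (U j \<omega>)) + norm (feedback (K \<rho> \<omega>)) + norm (\<mu> \<omega>)" for \<omega>
  have b: "b \<in> borel_measurable (past r)"
    unfolding b_def
    by (intro borel_measurable_add borel_measurable_sum measurable_compose[OF _ borel_measurable_norm]
        borel_measurable_feedback mean_measurable known_measurable) simp_all
  have "AE \<omega> in M. b \<omega> \<le> real k \<longrightarrow> ?Q \<omega>" for k :: nat
  proof -
    let ?E = "{\<omega> \<in> space M. b \<omega> \<le> real k}"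
    have "{\<omega> \<in> space (past r). b \<omega> \<le> real k} \<in> sets (past r)"
      using b by measurable
    then have "?E \<in> sets (past r)" by (simp only: space_past)
    moreover have "norm (L j \<omega>) + norm (U j \<omega>) \<le> (\<Sum>j\<le>\<rho>. norm (L j \<omega>) + norm (U j \<omega>))" if "j \<le> \<rho>" for j \<omega>
      using that by (intro member_le_sum) simp_all
    moreover have "0 \<le> (\<Sum>j\<le>\<rho>. norm (L j \<omega>) + norm (U j \<omega>))" for \<omega>
      by (intro sum_nonneg) simp
    ultimately have "AE \<omega> in M. \<omega> \<in> ?E \<longrightarrow> ?Q \<omega>"
      by (intro conditional_moments_on[where c = "real k"])
        (simp_all add: b_def, (smt (verit) norm_ge_zero)+)
    then show ?thesis using AE_space by eventually_elim auto
  qed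
  then have "AE \<omega> in M. \<forall>k::nat. b \<omega> \<le> real k \<longrightarrow> ?Q \<omega>"
    unfolding AE_all_countable by blast
  then show ?thesis
    by eventually_elim (use real_arch_simple in blast)
qed

end

section \<open>The mixing bound\<close>

theorem lemma1:
  fixes M :: "'a measure"
    and A :: "real ^ 'n ^ 'n" and B :: "real ^ 'm ^ 'n" and W :: "real ^ 'n ^ 'n"
    and x w :: "nat \<Rightarrow> 'a \<Rightarrow> real ^ 'n" and u v :: "nat \<Rightarrow> 'a \<Rightarrow> real ^ 'm"
    and \<Sigma> :: "nat \<Rightarrow> 'a \<Rightarrow> real ^ ('n::finite + 'm::finite) ^ ('n::finite + 'm::finite)"
    and \<eta> :: "nat \<Rightarrow> real" and \<sigma> \<zeta> \<nu> R \<sigma>' \<kappa> \<gamma> :: real and T t \<rho> :: nat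
  defines "F \<equiv> history M (x 1) v w \<Sigma>"
    and "z \<equiv> \<lambda>s \<omega>. stack (x s \<omega>) (u s \<omega>)"
    and "\<Theta> \<equiv> hcat A B"
  assumes system: "closed_loop M A B W \<sigma> T x u v w \<Sigma>"
    and times: "\<rho> < t" "t \<le> T"
    and eta_nonneg: "\<And>s. s \<in> {t-\<rho>..t} \<Longrightarrow> 0 \<le> \<eta> s"
    and sigma': "\<sigma>' = \<sigma> - Max (\<eta> ` {t-\<rho>..t})" "0 < \<sigma>'"
    and kappa: "\<kappa> = \<nu> / \<sigma>'" and gamma: "\<gamma> = \<sigma>' / (2 * \<nu>)"
    and target_known: "\<And>s. s \<in> {t-\<rho>..t} \<Longrightarrow> \<Sigma> s \<in> borel_measurable (F (t-\<rho>))"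
    and zeta: "\<zeta> \<le> \<sigma>'^2 / (2 * \<nu>)"
  shows "AE \<omega> in M.
    (\<forall>s\<in>{t-\<rho>..t}. Suc s \<le> T \<longrightarrow> opnorm (\<Sigma> (Suc s) \<omega> - \<Sigma> s \<omega>) \<le> \<zeta>) \<and>
    (\<forall>s\<in>{t-\<rho>..t}. \<Theta> ** \<Sigma> s \<omega> ** transpose \<Theta> + W - mat (\<eta> s) \<preceq> block_xx (\<Sigma> s \<omega>)) \<and>
    (\<forall>s\<in>{1..T}. 0 \<preceq> \<Sigma> s \<omega> \<and> \<Sigma> s \<omega> \<preceq> mat \<nu>) \<and>
    norm (x (t-\<rho>) \<omega>) \<le> R
    \<longrightarrow>
    norm (cond_mean M (F (t-\<rho>)) (z t) \<omega>) \<le> (1 + \<kappa>) * \<kappa> * exp (- \<gamma> * real \<rho> / 2) * R \<and>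
    cond_cov M (F (t-\<rho>)) (z t) \<omega> - \<Sigma> t \<omega> \<preceq>
      mat ((1 + \<kappa>)^2 * \<kappa>^2 * (\<nu> * exp (- \<gamma> * real \<rho>) + real \<rho> * \<zeta> + (\<Sum>s=t-\<rho>..t. \<eta> s)))"
proof -
  interpret closed_loop M A B W \<sigma> T x u v w \<Sigma> by (rule system)
  \<comment> \<open>The condition \<open>\<rho> < t\<close> makes the subtraction of naturals exact
    and \<open>r\<close> at least 1.\<close>
  define r where "r = t - \<rho>"
  have t: "r + \<rho> = t" and r: "1 \<le> r" using times by (simp_all add: r_def)
  note [folded r_def] = target_known eta_nonneg sigma'(1)
  note target_known = this(1) and eta_nonneg = this(2) and max_eta = this(3)
  have F: "F = past" by (simp add: F_def past_def fun_eq_iff)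
  interpret known: known_targets M A B W \<sigma> T x u v w \<Sigma> r \<rho>
  proof unfold_locales
    show "\<Sigma> (r + j) \<in> borel_measurable (past r)" if "j \<le> \<rho>" for j
      using target_known[of "r + j"] that t unfolding F by simp
  qed (use times r t in simp_all)
  have symW: "transpose W = W"
    using noise_cov by (simp add: loewner_le_def psd_def transpose_diff transpose_mat)
  \<comment> \<open>\<sigma>' subtracts the largest slack of the window, so
    \<open>\<sigma>' + \<eta> s\<close> is at most \<sigma> at each of its times.\<close>
  have noise: "mat (\<sigma>' + \<eta> s) \<preceq> W" if s: "s \<in> {r..t}" for s
  proof (rule loewner_leI)
    fix \<xi> :: "real ^ 'n"
    have "\<sigma>' + \<eta> s \<le> \<sigma>"
    proof -
      have "\<eta> s \<le> Max (\<eta> ` {r..t})" using s by (intro Max_ge) auto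
      then show ?thesis unfolding max_eta by linarith
    qed
    then have "(\<sigma>' + \<eta> s) * (\<xi> \<bullet> \<xi>) \<le> \<sigma> * (\<xi> \<bullet> \<xi>)" by (intro mult_right_mono) simp_all
    also have "\<dots> \<le> \<xi> \<bullet> (W *v \<xi>)"
      using loewner_leD[OF noise_cov, of \<xi>] by (simp add: matrix_vector_mult_mat)
    finally show "\<xi> \<bullet> (mat (\<sigma>' + \<eta> s) *v \<xi>) \<le> \<xi> \<bullet> (W *v \<xi>)" by (simp add: matrix_vector_mult_mat)
  qed (simp_all add: transpose_mat symW)
  show ?thesis
    unfolding r_def[symmetric]
    \<comment> \<open>The moment formulas hold off a null set. At any other outcome the rest is
      deterministic, and the pathwise assumptions are used at that outcome alone.\<close>
    using known.conditional_moments AE_space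
  proof eventually_elim
    case (elim \<omega>)
    show ?case
    proof (intro impI, elim conjE)
      assume drift: "\<forall>s\<in>{r..t}. Suc s \<le> T \<longrightarrow> opnorm (\<Sigma> (Suc s) \<omega> - \<Sigma> s \<omega>) \<le> \<zeta>"
        and stationary: "\<forall>s\<in>{r..t}. \<Theta> ** \<Sigma> s \<omega> ** transpose \<Theta> + W - mat (\<eta> s) \<preceq> block_xx (\<Sigma> s \<omega>)"
        and bounds: "\<forall>s\<in>{1..T}. 0 \<preceq> \<Sigma> s \<omega> \<and> \<Sigma> s \<omega> \<preceq> mat \<nu>"
        and initial: "norm (x r \<omega>) \<le> R"
      interpret drifting_targets A B W "\<lambda>j. \<Sigma> (r + j) \<omega>" \<sigma>' \<nu> \<zeta> "\<lambda>j. \<eta> (r + j)" \<rho>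
      proof (rule drifting_targets.intro)
        fix j
        assume j: "j \<le> \<rho>"
        then have s: "r + j \<in> {r..t}" "r + j \<in> {1..T}" using times r t by auto
        show "contractive_target A B W (\<Sigma> (r + j) \<omega>) \<sigma>' (\<eta> (r + j)) \<nu>"
          using s bounds stationary noise sigma'(2) unfolding \<Theta>_def by unfold_locales auto
        show "0 \<le> \<eta> (r + j)" using s by (intro eta_nonneg)
      next
        fix j
        assume "j < \<rho>"
        then show "opnorm (\<Sigma> (r + Suc j) \<omega> - \<Sigma> (r + j) \<omega>) \<le> \<zeta>"
          using drift times t by simp
      qed (rule zeta)
      have \<kappa>: "\<kappa> \<ge> 1" using rate unfolding kappa by simp
      have mean: "cond_mean M (F r) (z t) \<omega> =
          feedback (gain (\<Sigma> (r + \<rho>) \<omega>)) *v (transition (\<lambda>j. A + B ** gain (\<Sigma> (r + j) \<omega>)) \<rho> *v x r \<omega>)"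
        and cov: "cond_cov M (F r) (z t) \<omega> =
          feedback (gain (\<Sigma> (r + \<rho>) \<omega>)) ** state_cov (\<lambda>j. A + B ** gain (\<Sigma> (r + j) \<omega>))
            (\<lambda>j. B ** input_cov (\<Sigma> (r + j) \<omega>) ** transpose B + W) \<rho>
            ** transpose (feedback (gain (\<Sigma> (r + \<rho>) \<omega>)))
          + input_inclusion ** input_cov (\<Sigma> (r + \<rho>) \<omega>) ** transpose input_inclusion"
        using elim(1) unfolding F z_def t by auto
      have "norm (cond_mean M (F r) (z t) \<omega>) \<le> (1 + \<kappa>) * \<kappa> * exp (- \<gamma> * real \<rho> / 2) * norm (x r \<omega>)"
        unfolding mean kappa gamma by (rule norm_mean_le)
      also have "\<dots> \<le> (1 + \<kappa>) * \<kappa> * exp (- \<gamma> * real \<rho> / 2) * R"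
        using initial \<kappa> by (intro mult_left_mono) simp_all
      finally have 1: "norm (cond_mean M (F r) (z t) \<omega>) \<le> (1 + \<kappa>) * \<kappa> * exp (- \<gamma> * real \<rho> / 2) * R" .
      let ?c = "\<nu> * exp (- \<gamma> * real \<rho>) + real \<rho> * \<zeta> + (\<Sum>s=r..t. \<eta> s)"
      \<comment> \<open>The errors run over the \<rho> transitions before \<open>t\<close>; the
        slack at \<open>t\<close> is a nonnegative addition.\<close>
      have "(\<Sum>i<\<rho>. \<eta> (r + i)) = (\<Sum>s\<in>{r..<t}. \<eta> s)"
        using t by (subst sum.atLeastLessThan_shift_0) (auto simp: lessThan_atLeast0)
      also have "\<dots> \<le> (\<Sum>s=r..t. \<eta> s)"
        using eta_nonneg by (intro sum_mono2) auto
      \<comment> \<open>As the state covariance starts at 0, the exponential term enters as a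
        nonnegative enlargement of the bound.\<close>
      moreover have "0 \<le> \<nu> * exp (- \<gamma> * real \<rho>)"
        using margin by simp
      ultimately have sum_le: "(\<Sum>i<\<rho>. \<eta> (r + i) + \<zeta>) \<le> ?c"
        by (simp add: sum.distrib)
      have 2: "cond_cov M (F r) (z t) \<omega> - \<Sigma> t \<omega> \<preceq> mat ((1 + \<kappa>)\<^sup>2 * \<kappa>\<^sup>2 * ?c)"
      proof (rule loewner_leI)
        \<comment> \<open>The Loewner order includes symmetry; here the product under the
          expectation commutes.\<close>
        have "transpose (cond_cov M (F r) (z t) \<omega>) = cond_cov M (F r) (z t) \<omega>"
          by (simp add: cond_cov_def transpose_def vec_eq_iff mult.commute)
        moreover have "transpose (\<Sigma> t \<omega>) = \<Sigma> t \<omega>"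
          using times elim(2) by (intro target_symmetric) simp_all
        ultimately show "transpose (cond_cov M (F r) (z t) \<omega> - \<Sigma> t \<omega>) = cond_cov M (F r) (z t) \<omega> - \<Sigma> t \<omega>"
          by (simp add: transpose_diff)
        fix \<xi>
        have "\<xi> \<bullet> ((cond_cov M (F r) (z t) \<omega> - \<Sigma> (r + \<rho>) \<omega>) *v \<xi>)
            \<le> (1 + \<kappa>)\<^sup>2 * \<kappa>\<^sup>2 * (\<Sum>i<\<rho>. \<eta> (r + i) + \<zeta>) * (norm \<xi>)\<^sup>2"
          unfolding cov kappa by (rule cov_excess_le)
        also have "\<dots> \<le> (1 + \<kappa>)\<^sup>2 * \<kappa>\<^sup>2 * ?c * (norm \<xi>)\<^sup>2"
          using sum_le by (intro mult_right_mono mult_left_mono) simp_all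
        finally show "\<xi> \<bullet> ((cond_cov M (F r) (z t) \<omega> - \<Sigma> t \<omega>) *v \<xi>)
            \<le> \<xi> \<bullet> (mat ((1 + \<kappa>)\<^sup>2 * \<kappa>\<^sup>2 * ?c) *v \<xi>)"
          unfolding t by (simp add: matrix_vector_mult_mat power2_norm_eq_inner)
      qed (simp add: transpose_mat)
      show "norm (cond_mean M (F r) (z t) \<omega>) \<le> (1 + \<kappa>) * \<kappa> * exp (- \<gamma> * real \<rho> / 2) * R \<and>
        cond_cov M (F r) (z t) \<omega> - \<Sigma> t \<omega> \<preceq> mat ((1 + \<kappa>)\<^sup>2 * \<kappa>\<^sup>2 * ?c)"
        using 1 2 by (rule conjI)
    qed
  qed
qed

end
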